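(* Let $H=H^k_{\mathbb F}$ with $\mathbb F\in\{\mathbb R,\mathbb C,\mathbb H,\mathbb O\}$ and let $x\neq y$ be points in $H$. Then the bisector between $x$ and $y$ in $H$ is equal to the preimage, under the nearest point projection $H\to L$ onto the $\mathbb F$-line $L$ spanned by $x$ and $y$, of the bisector between $x$ and $y$ in $L$.
   Context: $H^k_{\mathbb F}$ is the hyperbolic space over $\mathbb F$ (with $k=2$ if $\mathbb F=\mathbb O$) with its standard symmetric metric normalized to have maximal sectional curvature $-1$. The bisector of two points $x,y$ in a metric space is the set of points of the space at equal distance to $x$ and $y$. For $\mathbb F\in\{\mathbb C,\mathbb H,\mathbb O\}$, the $\mathbb F$-line spanned by $x\ne y$ is the unique totally geodesic submanifold of $H$ of dimension $\dim_{\mathbb R}\mathbb F$ containing $x$ and $y$ that is isometric to real hyperbolic space of constant curvature $-4$. For $\mathbb F=\mathbb R$, the $\mathbb R$-line spanned by $x\neq y$ is the complete geodesic through $x$ and $y$. *)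

theory Defs
  imports "HOL-Analysis.Analysis"
begin

type_synonym quat = "complex \<times> complex"
type_synonym oct = "quat \<times> quat"

(* Cayley-Dickson doubling.  The inner product and norm that oct carries as a product type are
   those of \<real>^8, so x \<bullet> y = Re (cnj x * y). *)

definition quat_cnj :: "quat \<Rightarrow> quat" where
  "quat_cnj p = (cnj (fst p), - snd p)"

definition quat_mult :: "quat \<Rightarrow> quat \<Rightarrow> quat" where
  "quat_mult p q =
     (fst p * fst q - cnj (snd q) * snd p, snd q * fst p + snd p * cnj (fst q))"

definition oct_cnj :: "oct \<Rightarrow> oct" where
  "oct_cnj p = (quat_cnj (fst p), - snd p)"

definition oct_mult :: "oct \<Rightarrow> oct \<Rightarrow> oct" where
  "oct_mult p q =
     (quat_mult (fst p) (fst q) - quat_mult (quat_cnj (snd q)) (snd p),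
      quat_mult (snd q) (fst p) + quat_mult (snd p) (quat_cnj (fst q)))"

datatype division_algebra = Real_alg | Complex_alg | Quaternion_alg | Octonion_alg

(* All four algebras are realised as subalgebras of the octonions. *)

fun scalars :: "division_algebra \<Rightarrow> oct set" where
  "scalars Real_alg = range (\<lambda>r. ((complex_of_real r, 0), 0))"
| "scalars Complex_alg = range (\<lambda>z. ((z, 0), 0))"
| "scalars Quaternion_alg = range (\<lambda>q. (q, 0))"
| "scalars Octonion_alg = UNIV"

(* Ball model: x in F^k stands for the negative line spanned by (1, x_1, ..., x_k) with respect
   to the Hermitian form of signature (k,1); vectors are functions vanishing outside {..<k}. *)

definition hyp_space :: "division_algebra \<Rightarrow> nat \<Rightarrow> (nat \<Rightarrow> oct) set" where
  "hyp_space F k =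
     {x. (\<forall>i<k. x i \<in> scalars F) \<and> (\<forall>i\<ge>k. x i = 0) \<and> (\<Sum>i<k. (norm (x i))\<^sup>2) < 1}"

(* The expansion of |1 - (\<Sum>i<k. cnj (x i) * y i)|^2 over an associative algebra, as the lemma
   hyp_form_associative shows.  Over the octonions (k = 2) the double sum has to be read as
   \<Sum>i j. Re ((x_i * cnj x_j) * (y_j * cnj y_i)), and hyp_form is then the trace of the Jordan
   product of the Hermitian 3x3 matrices v v^* J and w w^* J with v = (1, x_1, x_2),
   w = (1, y_1, y_2) and J = diag(1, -1, -1). *)

definition hyp_form :: "nat \<Rightarrow> (nat \<Rightarrow> oct) \<Rightarrow> (nat \<Rightarrow> oct) \<Rightarrow> real" where
  "hyp_form k x y =
     1 - 2 * (\<Sum>i<k. x i \<bullet> y i)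
       + (\<Sum>i<k. \<Sum>j<k. oct_mult (x i) (oct_cnj (x j)) \<bullet> oct_mult (y i) (oct_cnj (y j)))"

lemma hyp_form_associative:
  assumes "\<And>i. i < k \<Longrightarrow> x i \<in> scalars Quaternion_alg"
    and "\<And>i. i < k \<Longrightarrow> y i \<in> scalars Quaternion_alg"
  shows "hyp_form k x y =
    (norm (((1, 0), 0) - (\<Sum>i<k. oct_mult (oct_cnj (x i)) (y i))))\<^sup>2"
proof -
  let ?e = "((1, 0), 0) :: oct"
  let ?p = "\<lambda>i. oct_mult (oct_cnj (x i)) (y i)"
  have 1: "?e \<bullet> oct_mult (oct_cnj a) b = a \<bullet> b" for a b :: oct
    by (simp add: oct_mult_def oct_cnj_def quat_mult_def quat_cnj_def inner_prod_def
        inner_complex_def algebra_simps)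
  have 2: "oct_mult (oct_cnj a) b \<bullet> oct_mult (oct_cnj c) d
         = oct_mult a (oct_cnj c) \<bullet> oct_mult b (oct_cnj d)"
    if "snd a = 0" "snd b = 0" "snd c = 0" "snd d = 0" for a b c d :: oct
    using that
    by (simp add: oct_mult_def oct_cnj_def quat_mult_def quat_cnj_def inner_prod_def
        inner_complex_def algebra_simps)
  have ee: "?e \<bullet> ?e = 1"
    by (simp add: inner_complex_def)
  have z: "snd (x i) = 0" "snd (y i) = 0" if "i < k" for i
    using assms(1)[OF that] assms(2)[OF that] by auto
  have "(norm (?e - (\<Sum>i<k. ?p i)))\<^sup>2
      = ?e \<bullet> ?e - 2 * (\<Sum>i<k. ?e \<bullet> ?p i) + (\<Sum>i<k. ?p i) \<bullet> (\<Sum>j<k. ?p j)"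
    unfolding power2_norm_eq_inner inner_diff_left inner_diff_right inner_sum_right[symmetric]
    by (simp add: inner_commute)
  also have "(\<Sum>i<k. ?p i) \<bullet> (\<Sum>j<k. ?p j) = (\<Sum>i<k. \<Sum>j<k. ?p i \<bullet> ?p j)"
    by (subst inner_sum_left) (simp only: inner_sum_right)
  also have "\<dots> = (\<Sum>i<k. \<Sum>j<k.
      oct_mult (x i) (oct_cnj (x j)) \<bullet> oct_mult (y i) (oct_cnj (y j)))"
    by (intro sum.cong refl 2) (auto simp: z)
  finally show ?thesis
    by (simp add: hyp_form_def 1 ee del: inner_Pair)
qed

(* Sectional curvature -1 over the reals, between -4 and -1 otherwise. *)

definition hyp_dist :: "nat \<Rightarrow> (nat \<Rightarrow> oct) \<Rightarrow> (nat \<Rightarrow> oct) \<Rightarrow> real" where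
  "hyp_dist k x y =
     arcosh (sqrt (hyp_form k x y /
       ((1 - (\<Sum>i<k. (norm (x i))\<^sup>2)) * (1 - (\<Sum>i<k. (norm (y i))\<^sup>2)))))"

definition bisector :: "'a set \<Rightarrow> ('a \<Rightarrow> 'a \<Rightarrow> real) \<Rightarrow> 'a \<Rightarrow> 'a \<Rightarrow> 'a set" where
  "bisector M d x y = {z \<in> M. d z x = d z y}"

definition nearest_point :: "('a \<Rightarrow> 'a \<Rightarrow> real) \<Rightarrow> 'a set \<Rightarrow> 'a \<Rightarrow> 'a" where
  "nearest_point d L z = (THE p. is_arg_min (d z) (\<lambda>q. q \<in> L) p)"

definition isometric :: "'a set \<Rightarrow> ('a \<Rightarrow> 'a \<Rightarrow> real) \<Rightarrow> 'b set \<Rightarrow> ('b \<Rightarrow> 'b \<Rightarrow> real) \<Rightarrow> bool" where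
  "isometric M d N e \<longleftrightarrow>
     (\<exists>f. bij_betw f M N \<and> (\<forall>x\<in>M. \<forall>y\<in>M. e (f x) (f y) = d x y))"

definition geodesic_line :: "'a set \<Rightarrow> ('a \<Rightarrow> 'a \<Rightarrow> real) \<Rightarrow> 'a set \<Rightarrow> bool" where
  "geodesic_line M d S \<longleftrightarrow> S \<subseteq> M \<and> isometric (UNIV :: real set) dist S d"

definition totally_geodesic :: "'a set \<Rightarrow> ('a \<Rightarrow> 'a \<Rightarrow> real) \<Rightarrow> 'a set \<Rightarrow> bool" where
  "totally_geodesic M d S \<longleftrightarrow> S \<subseteq> M \<and>
     (\<forall>p\<in>S. \<forall>q\<in>S. p \<noteq> q \<longrightarrow> (\<forall>G. geodesic_line M d G \<and> p \<in> G \<and> q \<in> G \<longrightarrow> G \<subseteq> S))"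

(* A complete totally geodesic submanifold of a Hadamard manifold is convex, so its intrinsic
   distance is the restriction of the ambient one.  Halving the distance turns curvature -1
   into curvature -4. *)

definition F_line :: "division_algebra \<Rightarrow> nat \<Rightarrow> (nat \<Rightarrow> oct) set \<Rightarrow> bool" where
  "F_line F k L \<longleftrightarrow>
     (if F = Real_alg then geodesic_line (hyp_space F k) (hyp_dist k) L
      else totally_geodesic (hyp_space F k) (hyp_dist k) L \<and>
        isometric L (hyp_dist k)
          (hyp_space Real_alg (dim (scalars F)))
          (\<lambda>u v. hyp_dist (dim (scalars F)) u v / 2))"

definition spanned_line ::
    "division_algebra \<Rightarrow> nat \<Rightarrow> (nat \<Rightarrow> oct) \<Rightarrow> (nat \<Rightarrow> oct) \<Rightarrow> (nat \<Rightarrow> oct) set" where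
  "spanned_line F k x y = (THE L. F_line F k L \<and> x \<in> L \<and> y \<in> L)"

end

theory Submission
  imports Defs
begin

text \<open>Everything rests on a hyperbolic Pythagorean theorem: every \<open>z\<close> in \<open>H\<close> has a foot \<open>w\<close> on the
  \<open>F\<close>-line \<open>L\<close> with \<open>cosh (d z p) = cosh (d z w) * cosh (d w p)\<close> for all \<open>p\<close> in \<open>L\<close>.  Hence \<open>w\<close> is the
  nearest point of \<open>L\<close> and \<open>d z x = d z y\<close> iff \<open>d w x = d w y\<close>.

  Writing \<open>L\<close> as an affine line \<open>p u = x + q u\<close> over \<open>F\<close>, both the norm of \<open>p u\<close> and
  \<open>hyp_form k z (p u)\<close> are quadratics in \<open>u\<close> whose leading part is a multiple of \<open>u \<bullet> u\<close>.  This
  identifies \<open>L\<close> with a ball carrying the Poincare metric of curvature \<open>-4\<close>, and the second quadratic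
  has zero discriminant, so that it is proportional to the one of a point \<open>w\<close> of \<open>L\<close>.

  The Pythagorean theorem and the triangle inequality in \<open>L\<close> also make \<open>L\<close> totally geodesic.
  If \<open>L'\<close> is another candidate through \<open>x\<close> and \<open>y\<close>, it contains the geodesic \<open>\<gamma>\<close> of \<open>L\<close> through them.  For
  \<open>z\<close> in \<open>L'\<close> with foot \<open>w\<close> in \<open>L\<close>, curvature \<open>-4\<close> in \<open>L'\<close> and in \<open>L\<close> gives
  \<open>1 + C * cosh (2 * t - t0) = (cosh (d z w))\<^sup>2 * (1 + C' * cosh (2 * t - t1))\<close> for all \<open>t\<close>, whence \<open>z = w\<close>.
  So \<open>L'\<close> is contained in \<open>L\<close>, and they agree since distance-preserving self-maps of real
  hyperbolic space are onto.\<close>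

section \<open>Octonions\<close>

notation oct_mult (infixl "\<odot>" 70)

lemma oct_mult_adjoint_left: "(a \<odot> b) \<bullet> c = b \<bullet> (oct_cnj a \<odot> c)"
  by (cases a rule: prod.exhaust; cases b rule: prod.exhaust; cases c rule: prod.exhaust)
    (auto simp: oct_mult_def oct_cnj_def quat_mult_def quat_cnj_def inner_prod_def
        inner_complex_def algebra_simps)

lemma oct_mult_adjoint_right: "(a \<odot> b) \<bullet> c = a \<bullet> (c \<odot> oct_cnj b)"
  by (cases a rule: prod.exhaust; cases b rule: prod.exhaust; cases c rule: prod.exhaust)
    (auto simp: oct_mult_def oct_cnj_def quat_mult_def quat_cnj_def inner_prod_def
        inner_complex_def algebra_simps)

text \<open>Left alternativity in the form used below. Together with its mirror image it does duty
  for associativity: a factor can be cancelled against its own conjugate.\<close>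

lemma oct_mult_cnj_left: "oct_cnj a \<odot> (a \<odot> b) = (a \<bullet> a) *\<^sub>R b"
  by (auto simp: oct_mult_def oct_cnj_def quat_mult_def quat_cnj_def inner_prod_def
        inner_complex_def algebra_simps prod_eq_iff complex_eq_iff)

lemma oct_mult_cnj_right: "(b \<odot> a) \<odot> oct_cnj a = (a \<bullet> a) *\<^sub>R b"
  by (auto simp: oct_mult_def oct_cnj_def quat_mult_def quat_cnj_def inner_prod_def
        inner_complex_def algebra_simps prod_eq_iff complex_eq_iff)

lemma oct_cnj_cnj [simp]: "oct_cnj (oct_cnj a) = a"
  by (simp add: oct_cnj_def quat_cnj_def)

lemma oct_cnj_mult: "oct_cnj (a \<odot> b) = oct_cnj b \<odot> oct_cnj a"
  by (simp add: oct_mult_def oct_cnj_def quat_mult_def quat_cnj_def prod_eq_iff complex_eq_iff algebra_simps)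

lemma oct_cnj_inner: "oct_cnj a \<bullet> oct_cnj b = a \<bullet> b"
  by (simp add: oct_cnj_def quat_cnj_def inner_prod_def inner_complex_def)

text \<open>Multiplicativity of the norm, obtained by moving \<open>a\<close> across the inner
  product and cancelling it against its conjugate.\<close>

lemma oct_mult_inner_same: "(a \<odot> b) \<bullet> (a \<odot> b) = (a \<bullet> a) * (b \<bullet> b)"
  by (simp add: oct_mult_adjoint_left oct_mult_cnj_left)

lemma bilinear_oct_mult: "bilinear oct_mult"
  unfolding bilinear_def
  by (auto intro!: linearI simp: oct_mult_def quat_mult_def quat_cnj_def prod_eq_iff complex_eq_iff algebra_simps)

interpretation oct_mult: bounded_bilinear oct_mult
  using bilinear_oct_mult by (simp add: bilinear_conv_bounded_bilinear)

lemma linear_oct_cnj: "linear oct_cnj"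
  by (auto intro!: linearI simp: oct_cnj_def quat_cnj_def prod_eq_iff complex_eq_iff)

text \<open>A vanishing second component makes an octonion a quaternion; by
  \<open>scalars_snd\<close> this covers the scalars of every algebra but the octonions.\<close>

lemma oct_mult_assoc:
  assumes "snd a = 0" "snd b = 0" "snd c = 0"
  shows "(a \<odot> b) \<odot> c = a \<odot> (b \<odot> c)"
  using assms by (auto simp: oct_mult_def oct_cnj_def quat_mult_def quat_cnj_def algebra_simps prod_eq_iff complex_eq_iff)

definition oct_one :: oct where "oct_one = ((1, 0), 0)"

lemma oct_one_mult [simp]: "oct_one \<odot> a = a" "a \<odot> oct_one = a"
  by (simp_all add: oct_one_def oct_mult_def quat_mult_def quat_cnj_def prod_eq_iff complex_eq_iff)

lemma oct_one_inner [simp]: "oct_one \<bullet> oct_one = 1"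
  by (simp add: oct_one_def inner_complex_def)

lemma oct_cnj_one [simp]: "oct_cnj oct_one = oct_one"
  by (simp add: oct_one_def oct_cnj_def quat_cnj_def)

section \<open>The scalars as subalgebras closed under conjugation\<close>

lemma subspace_scalars: "subspace (scalars F)"
proof (cases F)
  case Real_alg
  have "scalars F = (\<lambda>r. ((complex_of_real r, 0), 0)) ` UNIV" using Real_alg by simp
  moreover have "linear (\<lambda>r. ((complex_of_real r, 0), 0) :: oct)"
    by (auto intro!: linearI simp: scaleR_conv_of_real)
  ultimately show ?thesis using linear_subspace_image subspace_UNIV by metis
next
  case Complex_alg
  have "scalars F = (\<lambda>r. ((r, 0), 0)) ` UNIV" using Complex_alg by simp
  moreover have "linear (\<lambda>r. ((r, 0), 0) :: oct)" by (auto intro!: linearI)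
  ultimately show ?thesis using linear_subspace_image subspace_UNIV by metis
next
  case Quaternion_alg
  have "scalars F = (\<lambda>r. (r, 0)) ` UNIV" using Quaternion_alg by simp
  moreover have "linear (\<lambda>r. (r, 0) :: oct)" by (auto intro!: linearI)
  ultimately show ?thesis using linear_subspace_image subspace_UNIV by metis
qed (simp add: subspace_UNIV)

lemma scalars_mult: "a \<in> scalars F \<Longrightarrow> b \<in> scalars F \<Longrightarrow> a \<odot> b \<in> scalars F"
  by (cases F) (auto simp: oct_mult_def quat_mult_def quat_cnj_def image_iff zero_prod_def simp flip: of_real_mult)

lemma scalars_cnj: "a \<in> scalars F \<Longrightarrow> oct_cnj a \<in> scalars F"
  by (cases F) (auto simp: oct_cnj_def quat_cnj_def)

lemma scalars_one: "oct_one \<in> scalars F"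
  by (cases F) (auto simp: oct_one_def image_iff intro: exI[of _ 1])

lemma scalars_snd: "a \<in> scalars F \<Longrightarrow> F \<noteq> Octonion_alg \<Longrightarrow> snd a = 0"
  by (cases F) auto

lemma scalars_Real: "a \<in> scalars Real_alg \<longleftrightarrow> (\<exists>r. a = r *\<^sub>R oct_one)"
  by (auto simp: oct_one_def image_iff scaleR_conv_of_real)

section \<open>Perpendiculars in semimetric spaces\<close>

text \<open>The triangle inequality is kept apart as \<open>triangle_on\<close>: for
  \<open>hyp_dist\<close> it is derived on real hyperbolic space and on the lines, out of the
  Pythagorean theorem.\<close>

definition semimetric_on :: "'a set \<Rightarrow> ('a \<Rightarrow> 'a \<Rightarrow> real) \<Rightarrow> bool" where
  "semimetric_on M d \<longleftrightarrow>
     (\<forall>x\<in>M. \<forall>y\<in>M. 0 \<le> d x y \<and> d x y = d y x \<and> (d x y = 0 \<longleftrightarrow> x = y))"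

definition triangle_on :: "'a set \<Rightarrow> ('a \<Rightarrow> 'a \<Rightarrow> real) \<Rightarrow> bool" where
  "triangle_on M d \<longleftrightarrow> (\<forall>x\<in>M. \<forall>y\<in>M. \<forall>z\<in>M. d x z \<le> d x y + d y z)"

text \<open>The hyperbolic Pythagorean theorem: \<open>w\<close> is the foot of the perpendicular from \<open>z\<close> to \<open>L\<close>,
  and \<open>C\<close> is the cosh of its length.\<close>

definition foot :: "('a \<Rightarrow> 'a \<Rightarrow> real) \<Rightarrow> 'a set \<Rightarrow> 'a \<Rightarrow> 'a \<Rightarrow> real \<Rightarrow> bool" where
  "foot d L z w C \<longleftrightarrow> w \<in> L \<and> 1 \<le> C \<and> (\<forall>p\<in>L. cosh (d z p) = C * cosh (d w p)) \<and> (C = 1 \<longrightarrow> w = z)"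

definition pythagorean :: "'a set \<Rightarrow> ('a \<Rightarrow> 'a \<Rightarrow> real) \<Rightarrow> 'a set \<Rightarrow> bool" where
  "pythagorean M d L \<longleftrightarrow> L \<subseteq> M \<and> (\<forall>z\<in>M. \<exists>w C. foot d L z w C)"

lemma cosh_real_nonneg_eq_iff: "0 \<le> x \<Longrightarrow> 0 \<le> y \<Longrightarrow> cosh x = cosh y \<longleftrightarrow> x = y" for x y :: real
  by (metis cosh_real_nonneg_le_iff order_antisym order_refl)

text \<open>The factor \<open>C\<close> is at least 1, so passing from \<open>z\<close> to its foot
  does not increase the distance to any point of \<open>L\<close>.\<close>

lemma foot_le:
  assumes "semimetric_on M d" "L \<subseteq> M" "z \<in> M" "foot d L z w C" "p \<in> L"
  shows "d w p \<le> d z p"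
proof -
  have w: "w \<in> L" "1 \<le> C" and eq: "cosh (d z p) = C * cosh (d w p)"
    using assms by (auto simp: foot_def)
  have "cosh (d w p) \<le> cosh (d z p)"
    unfolding eq using w(2) cosh_real_ge_1[of "d w p"] by (simp add: mult_le_cancel_right1)
  moreover have "0 \<le> d w p" "0 \<le> d z p" using assms w by (auto simp: semimetric_on_def)
  ultimately show ?thesis by (simp add: cosh_real_nonneg_le_iff)
qed

text \<open>On \<open>L\<close> the distance from \<open>z\<close> is governed by
  \<open>C * cosh (d w p)\<close>, which is least at \<open>p = w\<close> and only there; this gives
  the definite description in \<open>nearest_point\<close> its value.\<close>

lemma nearest_point_eq_foot:
  assumes "semimetric_on M d" "L \<subseteq> M" "z \<in> M" "foot d L z w C"
  shows "nearest_point d L z = w"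
  unfolding nearest_point_def
proof (rule the_equality)
  have w: "w \<in> L" "1 \<le> C" and eq: "\<And>p. p \<in> L \<Longrightarrow> cosh (d z p) = C * cosh (d w p)"
    using assms by (auto simp: foot_def)
  have nn: "0 \<le> d z p" "0 \<le> d w p" if "p \<in> L" for p
    using assms w that by (auto simp: semimetric_on_def)
  have ww: "d w w = 0" using assms w by (auto simp: semimetric_on_def)
  have le: "d z w \<le> d z p" if "p \<in> L" for p
  proof -
    have "cosh (d z w) \<le> cosh (d z p)"
      using eq[OF that] eq[OF w(1)] w(2) cosh_real_ge_1[of "d w p"]
      by (simp add: ww mult_le_cancel_left1)
    thus ?thesis using nn that w(1) by (simp add: cosh_real_nonneg_le_iff)
  qed
  show "is_arg_min (d z) (\<lambda>q. q \<in> L) w"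
    using w(1) le by (force simp: is_arg_min_def)
  fix p assume "is_arg_min (d z) (\<lambda>q. q \<in> L) p"
  hence p: "p \<in> L" and "\<not> d z w < d z p" using w(1) by (auto simp: is_arg_min_def)
  hence "d z p = d z w" using le[OF p] by simp
  hence "C * cosh (d w p) = C" using eq[OF p] eq[OF w(1)] by (simp add: ww)
  hence "cosh (d w p) = cosh 0" using w(2) by simp
  hence "d w p = 0" using cosh_real_nonneg_eq_iff[OF nn(2)[OF p], of 0] by simp
  thus "p = w" using assms(1) p w(1) subsetD[OF assms(2) p] subsetD[OF assms(2) w(1)]
    by (auto simp: semimetric_on_def)
qed

text \<open>The common factor \<open>C\<close> cancels from \<open>cosh (d z x)\<close> and
  \<open>cosh (d z y)\<close>, so equidistance from \<open>x\<close> and \<open>y\<close> passes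
  between \<open>z\<close> and its foot.\<close>

lemma bisector_pythagorean:
  assumes "semimetric_on M d" "pythagorean M d L" "x \<in> L" "y \<in> L"
  shows "bisector M d x y = {z \<in> M. nearest_point d L z \<in> bisector L d x y}"
proof -
  have "d z x = d z y \<longleftrightarrow> nearest_point d L z \<in> bisector L d x y" if z: "z \<in> M" for z
  proof -
    obtain w C where f: "foot d L z w C" and LM: "L \<subseteq> M"
      using assms(2) z by (auto simp: pythagorean_def)
    have w: "w \<in> L" "1 \<le> C" and eq: "\<And>p. p \<in> L \<Longrightarrow> cosh (d z p) = C * cosh (d w p)"
      using f by (auto simp: foot_def)
    have nn: "0 \<le> d z p" "0 \<le> d w p" if "p \<in> L" for p
      using assms LM w z that by (auto simp: semimetric_on_def)
    have "d z x = d z y \<longleftrightarrow> d w x = d w y"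
      using cosh_real_nonneg_eq_iff[OF nn(1)[OF assms(3)] nn(1)[OF assms(4)]]
        cosh_real_nonneg_eq_iff[OF nn(2)[OF assms(3)] nn(2)[OF assms(4)]]
        eq[OF assms(3)] eq[OF assms(4)] w(2) by simp
    thus ?thesis
      using nearest_point_eq_foot[OF assms(1) LM z f] w(1) by (simp add: bisector_def)
  qed
  thus ?thesis by (auto simp: bisector_def)
qed

section \<open>Geodesic lines and totally geodesic subsets\<close>

lemma geodesic_line_range:
  assumes "semimetric_on M d" "\<And>t. f t \<in> M" "\<And>s t. d (f s) (f t) = \<bar>s - t\<bar>"
  shows "geodesic_line M d (range f)"
proof -
  have "inj f"
  proof (rule injI)
    fix s t assume "f s = f t"
    hence "d (f s) (f t) = 0" using assms(1,2) by (simp add: semimetric_on_def)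
    thus "s = t" using assms(3) by simp
  qed
  thus ?thesis
    using assms unfolding geodesic_line_def isometric_def
    by (intro conjI exI[of _ f]) (auto simp: bij_betw_def dist_real_def)
qed

lemma geodesic_lineE:
  assumes "geodesic_line M d S"
  obtains f where "range f = S" "\<And>t. f t \<in> M" "\<And>s t. d (f s) (f t) = \<bar>s - t\<bar>"
proof -
  obtain f :: "real \<Rightarrow> 'a"
    where "bij_betw f UNIV S" "\<And>s t. d (f s) (f t) = dist s t" "S \<subseteq> M"
    using assms unfolding geodesic_line_def isometric_def by blast
  thus thesis using that[of f] by (force simp: bij_betw_def dist_real_def)
qed

text \<open>Models a segment from \<open>p\<close> over \<open>q\<close> to \<open>z\<close>, with
  \<open>s\<close> and \<open>t\<close> its two pieces and \<open>a\<close>, \<open>b\<close> the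
  distances of the foot of \<open>z\<close> from \<open>p\<close> and \<open>q\<close>. The addition
  theorem reduces the bound on \<open>a\<close> to \<open>sinh t \<le> C * sinh b\<close>;
  subtracting squares from \<open>cosh t = C * cosh b\<close> leaves
  \<open>C\<^sup>2 \<le> 1\<close>.\<close>

lemma cosh_scale_eq_1:
  fixes a b s t C :: real
  assumes "cosh (s + t) = C * cosh a" "cosh t = C * cosh b" "0 \<le> a" "a \<le> b + s"
    "0 < s" "0 \<le> t" "0 \<le> b" "1 \<le> C"
  shows "C = 1"
proof -
  have "cosh a \<le> cosh (b + s)" using assms by (simp add: cosh_real_nonneg_le_iff)
  hence "cosh (s + t) \<le> C * cosh (b + s)" using assms by simp
  also have "\<dots> = cosh t * cosh s + sinh s * (C * sinh b)"
    using assms(2) by (simp add: cosh_add algebra_simps)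
  finally have "sinh s * sinh t \<le> sinh s * (C * sinh b)"
    by (simp add: cosh_add algebra_simps)
  hence "sinh t \<le> C * sinh b" using assms by (simp add: mult_le_cancel_left)
  hence "(sinh t)\<^sup>2 \<le> (C * sinh b)\<^sup>2" using assms by (intro power_mono) auto
  moreover have "(cosh t)\<^sup>2 = (C * cosh b)\<^sup>2" using assms(2) by simp
  ultimately have "C\<^sup>2 \<le> 1"
    by (simp add: cosh_square_eq power_mult_distrib algebra_simps)
  thus ?thesis using assms(8) by (simp add: power2_le_iff_abs_le abs_square_le_1)
qed

text \<open>Metric collinearity with two distinct points of \<open>L\<close> forces
  \<open>C = 1\<close>. If \<open>z\<close> lies between them, the triangle inequality at the foot
  leaves no room for a strict decrease of distances; otherwise \<open>cosh_scale_eq_1\<close>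
  applies.\<close>

lemma foot_geodesic:
  assumes M: "semimetric_on M d" "L \<subseteq> M" and L: "triangle_on L d"
    and f: "foot d L z w C" "z \<in> M" and pq: "p \<in> L" "q \<in> L" "p \<noteq> q"
    and coll: "d p q = d z p + d z q \<or> d z p = d p q + d z q \<or> d z q = d p q + d z p"
  shows "z \<in> L"
proof -
  have w: "w \<in> L" "1 \<le> C" and eq: "\<And>p. p \<in> L \<Longrightarrow> cosh (d z p) = C * cosh (d w p)"
    and z: "C = 1 \<Longrightarrow> w = z"
    using f by (auto simp: foot_def)
  have nn: "0 \<le> d z p" "0 \<le> d w p" "d w p = d p w" if "p \<in> L" for p
    using assms w that by (auto simp: semimetric_on_def)
  have D: "0 < d p q" "d p q = d q p"
    using M(1) pq subsetD[OF M(2) pq(1)] subsetD[OF M(2) pq(2)]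
    by (auto simp: semimetric_on_def order.strict_iff_order)
  have tri: "d p q \<le> d w p + d w q" "d w p \<le> d w q + d p q" "d w q \<le> d w p + d p q"
    using L w(1) pq nn D(2) unfolding triangle_on_def by metis+
  have "C = 1"
    using coll
  proof (elim disjE)
    assume "d p q = d z p + d z q"
    hence "d w p = d z p"
      using tri foot_le[OF M f(2,1) pq(1)] foot_le[OF M f(2,1) pq(2)] by linarith
    thus ?thesis using eq[OF pq(1)] cosh_real_pos[of "d z p"] by simp
  next
    assume "d z p = d p q + d z q"
    thus ?thesis
      using cosh_scale_eq_1[of "d p q" "d z q" C "d w p" "d w q"]
        eq[OF pq(1)] eq[OF pq(2)] nn[OF pq(1)] nn[OF pq(2)] tri D w(2) by simp
  next
    assume "d z q = d p q + d z p"
    thus ?thesis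
      using cosh_scale_eq_1[of "d p q" "d z p" C "d w q" "d w p"]
        eq[OF pq(1)] eq[OF pq(2)] nn[OF pq(1)] nn[OF pq(2)] tri D w(2) by simp
  qed
  thus ?thesis using z w(1) by simp
qed

lemma pythagorean_totally_geodesic:
  assumes M: "semimetric_on M d" and L: "triangle_on L d" and "pythagorean M d L"
  shows "totally_geodesic M d L"
  unfolding totally_geodesic_def
proof (intro conjI ballI impI allI)
  show LM: "L \<subseteq> M" using assms by (simp add: pythagorean_def)
  fix p q G assume pq: "p \<in> L" "q \<in> L" "p \<noteq> q" and G: "geodesic_line M d G \<and> p \<in> G \<and> q \<in> G"
  obtain f where f: "range f = G" "\<And>t. f t \<in> M" "\<And>s t. d (f s) (f t) = \<bar>s - t\<bar>"
    using G geodesic_lineE by metis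
  obtain a b where ab: "p = f a" "q = f b" using G f(1) by auto
  have "f t \<in> L" for t
  proof -
    obtain w C where "foot d L (f t) w C" using assms(3) f(2) unfolding pythagorean_def by blast
    thus ?thesis
      by (rule foot_geodesic[OF M LM L _ f(2) pq]) (auto simp: ab f(3))
  qed
  thus "G \<subseteq> L" using f(1) by auto
qed

text \<open>Each \<open>h s\<close> is one of \<open>h 0 + s\<close> and \<open>h 0 - s\<close>. If
  \<open>t\<close> were missed, the arguments \<open>t - h 0\<close> and \<open>h 0 - t\<close>
  would both go to the mirror image of \<open>t\<close> in \<open>h 0\<close>; so they coincide, and
  \<open>t = h 0\<close> is attained after all.\<close>

lemma real_isometry_surj:
  fixes h :: "real \<Rightarrow> real"
  assumes "\<And>s t. \<bar>h s - h t\<bar> = \<bar>s - t\<bar>"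
  shows "surj h"
proof -
  have "\<exists>s. h s = t" for t
  proof (rule ccontr)
    assume *: "\<nexists>s. h s = t"
    have 0: "\<bar>h s - h 0\<bar> = \<bar>s\<bar>" for s using assms[of s 0] by simp
    have "h (t - h 0) = h 0 - (t - h 0)" "h (h 0 - t) = h 0 + (h 0 - t)"
      using 0[of "t - h 0"] 0[of "h 0 - t"] * by (smt (verit))+
    hence "h (t - h 0) = h (h 0 - t)" by simp
    hence "t - h 0 = h 0 - t" using assms[of "t - h 0" "h 0 - t"] by simp
    thus False using * by (auto intro: exI[of _ 0])
  qed
  thus ?thesis by (metis surjI)
qed

section \<open>The hyperboloid model\<close>

text \<open>The vector \<open>X\<close> stands for the point \<open>(sqrt (1 + X \<bullet> X), X)\<close> of the hyperboloid, and
  \<open>hyperboloid_form\<close> is the Lorentz product, i.e. the cosh of the distance at curvature \<open>-1\<close>.\<close>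

definition hyperboloid_form :: "'a::real_inner \<Rightarrow> 'a \<Rightarrow> real" where
  "hyperboloid_form X Y = sqrt (1 + X \<bullet> X) * sqrt (1 + Y \<bullet> Y) - X \<bullet> Y"

text \<open>The map extends to a linear map \<open>T\<close> of \<open>W = UNIV \<times> V\<close>
  preserving the Lorentz product \<open>B\<close>. Nondegeneracy of \<open>B\<close> makes
  \<open>T\<close> injective, hence onto by dimension, and a preimage of a point of the sheet of all
  \<open>\<Phi> X\<close> lies on that sheet again.\<close>

lemma hyperboloid_isometry_surj:
  fixes f :: "'a::euclidean_space \<Rightarrow> 'a"
  assumes V: "subspace V" and fV: "\<And>X. X \<in> V \<Longrightarrow> f X \<in> V"
    and iso: "\<And>X Y. X \<in> V \<Longrightarrow> Y \<in> V \<Longrightarrow> hyperboloid_form (f X) (f Y) = hyperboloid_form X Y"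
  shows "f ` V = V"
proof -
  define B :: "real \<times> 'a \<Rightarrow> real \<times> 'a \<Rightarrow> real" where "B u v = fst u * fst v - snd u \<bullet> snd v" for u v
  define \<Phi> :: "'a \<Rightarrow> real \<times> 'a" where "\<Phi> X = (sqrt (1 + X \<bullet> X), X)" for X
  have BPhi: "B (\<Phi> X) (\<Phi> Y) = hyperboloid_form X Y" for X Y
    by (simp add: B_def \<Phi>_def hyperboloid_form_def)
  have bil: "bilinear B"
    unfolding bilinear_def B_def by (auto intro!: linearI simp: algebra_simps inner_add)
  note Bsimps = bilinear_ladd[OF bil] bilinear_radd[OF bil] bilinear_lmul[OF bil] bilinear_rmul[OF bil]
    bilinear_lsub[OF bil] bilinear_rsub[OF bil] bilinear_lzero[OF bil] bilinear_rzero[OF bil]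
  define W where "W = (UNIV :: real set) \<times> V"
  have W: "subspace W" unfolding W_def by (intro subspace_Times subspace_UNIV V)
  have PhiW: "\<Phi> X \<in> W" if "X \<in> V" for X using that by (simp add: \<Phi>_def W_def)
  have nondeg: "e = 0" if "e \<in> W" "\<And>v. v \<in> W \<Longrightarrow> B e v = 0" for e
  proof -
    \<comment> \<open>Pairing \<open>e\<close> with its mirror image turns the Lorentz product into
      the Euclidean square of \<open>e\<close>.\<close>
    have "(fst e, - snd e) \<in> W" using that(1) V by (auto simp: W_def mem_Times_iff subspace_neg)
    from that(2)[OF this] have "(fst e)\<^sup>2 + snd e \<bullet> snd e = 0" by (simp add: B_def power2_eq_square)
    hence "fst e = 0 \<and> snd e = 0"
      using add_nonneg_eq_0_iff[of "(fst e)\<^sup>2" "snd e \<bullet> snd e"] by simp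
    thus ?thesis by (simp add: prod_eq_iff)
  qed
  \<comment> \<open>Choosing the basis among points of the sheet lets \<open>T\<close> be prescribed
    by \<open>f\<close> on it.\<close>
  obtain S where S: "S \<subseteq> \<Phi> ` V" "independent S" "\<Phi> ` V \<subseteq> span S"
    by (rule maximal_independent_subset)
  have spanS: "span S = W"
  proof
    show "span S \<subseteq> W" using S(1) PhiW W by (intro span_minimal) auto
    show "W \<subseteq> span S"
    proof
      fix u assume u: "u \<in> W"
      hence m: "\<Phi> 0 \<in> span S" "\<Phi> (snd u) \<in> span S"
        using S(3) V by (auto simp: W_def subspace_0)
      \<comment> \<open>\<open>\<Phi> 0\<close> is \<open>(1, 0)\<close>, so a multiple of it
        corrects the first coordinate.\<close>
      have "u = \<Phi> (snd u) + (fst u - sqrt (1 + snd u \<bullet> snd u)) *\<^sub>R \<Phi> 0"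
        by (simp add: \<Phi>_def prod_eq_iff)
      also have "\<dots> \<in> span S" using m by (intro span_add span_scale)
      finally show "u \<in> span S" .
    qed
  qed
  obtain T where T: "linear T" "\<And>u. u \<in> S \<Longrightarrow> T u = \<Phi> (f (snd u))"
    using linear_independent_extend[OF S(2), of "\<lambda>u. \<Phi> (f (snd u))"] by blast
  have TPhiS: "T u = \<Phi> (f X)" if "u \<in> S" "u = \<Phi> X" for u X
    using T(2)[OF that(1)] that(2) by (simp add: \<Phi>_def)
  have TB: "B (T u) (T v) = B u v" if "u \<in> W" "v \<in> W" for u v
  proof (rule bilinear_eq[of "\<lambda>u v. B (T u) (T v)" B W S W S])
    show "bilinear (\<lambda>u v. B (T u) (T v))"
      unfolding bilinear_def
      by (intro conjI allI linearI) (simp_all add: Bsimps linear_add[OF T(1)] linear_scale[OF T(1)])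
    fix u v assume uv: "u \<in> S" "v \<in> S"
    then obtain X Y where "X \<in> V" "Y \<in> V" "u = \<Phi> X" "v = \<Phi> Y" using S(1) by blast
    thus "B (T u) (T v) = B u v" using TPhiS uv iso by (simp add: BPhi)
  qed (use bil spanS that in auto)
  have TW: "T ` W = W"
  proof (rule subspace_dim_equal)
    show "subspace (T ` W)" by (rule linear_subspace_image[OF T(1) W])
    have "T ` S \<subseteq> W"
    proof
      fix u' assume "u' \<in> T ` S"
      then obtain u X where "u \<in> S" "u' = T u" "X \<in> V" "u = \<Phi> X" using S(1) by blast
      thus "u' \<in> W" using TPhiS fV PhiW by simp
    qed
    hence "span (T ` S) \<subseteq> W" using W by (intro span_minimal)
    thus "T ` W \<subseteq> W" using linear_span_image[OF T(1), of S] spanS by simp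
    have "inj_on T W"
      unfolding linear_inj_on_iff_eq_0[OF T(1) W]
    proof (intro ballI impI)
      fix u assume u: "u \<in> W" "T u = 0"
      show "u = 0" using nondeg[OF u(1)] TB[OF u(1)] u(2) by (simp add: Bsimps)
    qed
    moreover have "span W = W" using spanS by (metis span_span)
    ultimately have "dim (T ` W) = dim W" using dim_image_eq[OF T(1), of W] by metis
    thus "dim W \<le> dim (T ` W)" by simp
  qed (rule W)
  have TPhi: "T (\<Phi> X) = \<Phi> (f X)" if X: "X \<in> V" for X
  proof -
    \<comment> \<open>Off the basis, \<open>T\<close> agrees with \<open>f\<close> by nondegeneracy:
      the difference is orthogonal to the image of the spanning set \<open>S\<close>, hence to all
      of \<open>W\<close>.\<close>
    let ?e = "T (\<Phi> X) - \<Phi> (f X)"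
    have eW: "?e \<in> W" using TW PhiW fV X W by (intro subspace_diff) auto
    have lin: "linear (\<lambda>v. B ?e (T v))"
      by (intro linearI) (simp_all add: Bsimps linear_add[OF T(1)] linear_scale[OF T(1)])
    have "B ?e (T v) = 0" if "v \<in> span S" for v
    proof (rule linear_eq_0_on_span[OF lin _ that])
      fix u assume u: "u \<in> S"
      then obtain Y where Y: "Y \<in> V" "u = \<Phi> Y" using S(1) by blast
      have "B (T (\<Phi> X)) (T u) = B (\<Phi> (f X)) (T u)"
        using TB[OF PhiW[OF X] PhiW[OF Y(1)]] TPhiS[OF u Y(2)] Y iso[OF X Y(1)] by (simp add: BPhi)
      thus "B ?e (T u) = 0" by (simp add: Bsimps)
    qed
    hence "B ?e v = 0" if "v \<in> T ` W" for v using that spanS by auto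
    hence "?e = 0" unfolding TW by (rule nondeg[OF eW])
    thus ?thesis by simp
  qed
  have "Z \<in> f ` V" if Z: "Z \<in> V" for Z
  proof -
    have "\<Phi> Z \<in> T ` W" using TW PhiW[OF Z] by simp
    then obtain u where u: "u \<in> W" "T u = \<Phi> Z" by auto
    have "B u u = hyperboloid_form Z Z" using TB[OF u(1) u(1)] u(2) by (simp add: BPhi)
    hence 1: "(fst u)\<^sup>2 = 1 + snd u \<bullet> snd u"
      by (simp add: B_def hyperboloid_form_def power2_eq_square)
    have 0: "0 \<in> V" using V by (rule subspace_0)
    \<comment> \<open>The first coordinate is the product with \<open>\<Phi> 0\<close>, which
      \<open>T\<close> preserves; its sign rules out the lower sheet.\<close>
    have "fst u = B u (\<Phi> 0)" by (simp add: B_def \<Phi>_def)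
    also have "\<dots> = B (\<Phi> Z) (\<Phi> (f 0))" using TB[OF u(1) PhiW[OF 0]] u(2) TPhi[OF 0] by simp
    also have "\<dots> \<ge> 0"
    proof -
      have "\<bar>Z \<bullet> f 0\<bar> \<le> norm Z * norm (f 0)" by (rule Cauchy_Schwarz_ineq2)
      also have "\<dots> \<le> sqrt (1 + Z \<bullet> Z) * sqrt (1 + f 0 \<bullet> f 0)"
        by (intro mult_mono) (auto simp: norm_eq_sqrt_inner)
      finally show ?thesis by (simp add: BPhi hyperboloid_form_def)
    qed
    finally have "fst u = sqrt (1 + snd u \<bullet> snd u)" using 1 by (simp add: real_sqrt_unique)
    hence "u = \<Phi> (snd u)" by (simp add: \<Phi>_def prod_eq_iff)
    moreover have sV: "snd u \<in> V" using u(1) by (auto simp: W_def)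
    ultimately have "\<Phi> Z = \<Phi> (f (snd u))" using u(2) TPhi[OF sV] by simp
    thus ?thesis using sV by (auto simp: \<Phi>_def)
  qed
  thus ?thesis using fV by auto
qed

section \<open>Charts of lines\<close>

lemma inner_diff_self: "(u - v) \<bullet> (u - v) = u \<bullet> u - 2 * (u \<bullet> v) + v \<bullet> v" for u v :: "'a::real_inner"
  by (simp add: inner_diff inner_commute algebra_simps)

text \<open>A quadratic \<open>a + 2 * (l \<bullet> w) + c * (w \<bullet> w)\<close> with \<open>l \<bullet> l = a * c\<close> is a multiple of the squared
  distance to a point (possibly at infinity).  The lower bound keeps this zero outside the closed
  unit ball; its mirror image in the unit sphere will be the foot of a perpendicular.\<close>

lemma null_quadratic_pole:
  fixes l :: "'a::real_inner"
  assumes V: "subspace V" "l \<in> V" and null: "l \<bullet> l = a * c" and c: "0 \<le> c" and M: "0 < M"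
    and ge: "\<And>w. w \<in> V \<Longrightarrow> w \<bullet> w < 1 \<Longrightarrow> M * (1 - w \<bullet> w) \<le> a + 2 * (l \<bullet> w) + c * (w \<bullet> w)"
  shows "0 < a" "c < a"
proof -
  show a: "0 < a" using ge[of 0] V M by (simp add: subspace_0)
  \<comment> \<open>The quadratic restricted to the ray that contains its zero, evaluated at
    \<open>- s *\<^sub>R l\<close>.\<close>
  have on_ray: "M * (1 - s\<^sup>2 * (a * c)) \<le> a * (1 - s * c)\<^sup>2" if "s\<^sup>2 * (a * c) < 1" for s
    using ge[OF subspace_scale[OF V, of "- s"]] that null
    by (simp add: power2_eq_square algebra_simps)
  show "c < a"
  proof (rule ccontr)
    assume "\<not> c < a"
    then consider "a < c" | "a = c" by linarith
    thus False
    proof cases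
      case 1
      \<comment> \<open>The zero lies inside the open ball, where the lower bound is
        positive.\<close>
      thus False using on_ray[of "1 / c"] a M by (simp add: power2_eq_square field_simps)
    next
      case 2
      \<comment> \<open>The zero lies on the unit sphere. At distance \<open>t\<close> from it along
        the ray, the lower bound is of order \<open>t\<close> but the quadratic is
        \<open>a * t\<^sup>2\<close>; at \<open>t = M / (2 * a)\<close> they already
        conflict.\<close>
      define t where "t = M / (2 * a)"
      have "M \<le> a" using ge[of 0] V by (simp add: subspace_0)
      hence t: "0 < t" "t < 1" "a * t = M / 2" using a M by (auto simp: t_def field_simps)
      have "(1 - t)\<^sup>2 < 1" using t by (simp add: abs_square_less_1)
      moreover have "((1 - t) / c)\<^sup>2 * (a * c) = (1 - t)\<^sup>2"
        using 2 a by (simp add: power2_eq_square field_simps)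
      ultimately have "M * (1 - (1 - t)\<^sup>2) \<le> a * (1 - (1 - t) / c * c)\<^sup>2"
        using on_ray[of "(1 - t) / c"] by simp
      also have "\<dots> = (a * t) * t" using 2 a by (simp add: power2_eq_square)
      finally have "t * (M * (2 - t)) \<le> t * (M / 2)"
        using t(3) by (simp add: power2_eq_square algebra_simps)
      hence "M * (2 - t) \<le> M / 2" using t(1) by (simp only: mult_le_cancel_left_pos)
      hence "M * (2 - t) \<le> M * (1 / 2)" by simp
      thus False using M t by (simp only: mult_le_cancel_left) simp
    qed
  qed
qed

text \<open>Up to powers of \<open>K\<close>, the values of \<open>N\<close> and \<open>h\<close> on
  the image of \<open>Q\<close> are the data of the Poincare ball, and \<open>P\<close> is
  \<open>Q\<close> after stereographic projection from the hyperboloid. The quadratic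
  \<open>h z (Q w)\<close> has its zero outside the closed ball, and inversion in the unit sphere
  turns that zero into the foot.\<close>

lemma ball_chart:
  fixes Q :: "'a::real_inner \<Rightarrow> 'p" and N :: "'p \<Rightarrow> real"
  assumes V: "subspace V" and K: "0 < K"
    and N: "\<And>w. w \<in> V \<Longrightarrow> N (Q w) = K * (1 - w \<bullet> w)"
    and QH: "\<And>w. w \<in> V \<Longrightarrow> w \<bullet> w < 1 \<Longrightarrow> Q w \<in> H"
    and NH: "\<And>z. z \<in> H \<Longrightarrow> 0 < N z"
    and QQ: "\<And>w v. w \<in> V \<Longrightarrow> v \<in> V \<Longrightarrow>
      h (Q w) (Q v) = K\<^sup>2 * ((1 - w \<bullet> w) * (1 - v \<bullet> v) + (w - v) \<bullet> (w - v))"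
    and zQ: "\<And>z. z \<in> H \<Longrightarrow> \<exists>a l c. l \<in> V \<and> 0 \<le> c \<and> l \<bullet> l = a * c \<and>
      (\<forall>w\<in>V. h z (Q w) = a + 2 * (l \<bullet> w) + c * (w \<bullet> w))"
    and ge: "\<And>z w. z \<in> H \<Longrightarrow> w \<in> H \<Longrightarrow> N z * N w \<le> h z w"
  shows "\<exists>P. P ` V = Q ` {w \<in> V. w \<bullet> w < 1} \<and>
      (\<forall>X\<in>V. \<forall>Y\<in>V. 2 * (h (P X) (P Y) / (N (P X) * N (P Y))) - 1 = hyperboloid_form X Y) \<and>
      (\<forall>z\<in>H. \<exists>Z\<in>V. \<exists>C. \<forall>X\<in>V.
        h z (P X) / (N z * N (P X)) = C * (h (P Z) (P X) / (N (P Z) * N (P X))))"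
proof -
  \<comment> \<open>Stereographic projection from the hyperboloid to the ball;
    \<open>\<sigma>\<close> will be its inverse.\<close>
  define \<rho> :: "'a \<Rightarrow> 'a" where "\<rho> X = (1 / (1 + sqrt (1 + X \<bullet> X))) *\<^sub>R X" for X
  define \<sigma> :: "'a \<Rightarrow> 'a" where "\<sigma> w = (2 / (1 - w \<bullet> w)) *\<^sub>R w" for w
  have rhoV: "\<rho> X \<in> V" if "X \<in> V" for X using that V by (simp add: \<rho>_def subspace_scale)
  have T: "1 \<le> sqrt (1 + X \<bullet> X)" "X \<bullet> X = (sqrt (1 + X \<bullet> X))\<^sup>2 - 1" for X :: 'a
    by auto
  have rho2: "\<rho> X \<bullet> \<rho> Y = X \<bullet> Y / ((1 + sqrt (1 + X \<bullet> X)) * (1 + sqrt (1 + Y \<bullet> Y)))" for X Y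
    by (simp add: \<rho>_def)
  have rho: "1 - \<rho> X \<bullet> \<rho> X = 2 / (1 + sqrt (1 + X \<bullet> X))" for X
  proof -
    define t where "t = sqrt (1 + X \<bullet> X)"
    have t: "1 \<le> t" "X \<bullet> X = t\<^sup>2 - 1" using T[of X] by (simp_all add: t_def)
    show ?thesis
      unfolding rho2 t_def[symmetric] t(2)
      using t(1) by (simp add: power2_eq_square divide_simps) (simp add: algebra_simps)
  qed
  have rho1: "\<rho> X \<bullet> \<rho> X < 1" for X
  proof -
    have "0 < 1 + sqrt (1 + X \<bullet> X)" using T(1)[of X] by linarith
    hence "0 < 2 / (1 + sqrt (1 + X \<bullet> X))" by (rule divide_pos_pos[rotated]) simp
    thus ?thesis using rho[of X] by linarith
  qed
  have sigma: "\<rho> (\<sigma> w) = w" "\<sigma> w \<in> V" if "w \<in> V" "w \<bullet> w < 1" for w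
  proof -
    let ?s = "w \<bullet> w"
    have "1 + \<sigma> w \<bullet> \<sigma> w = ((1 + ?s) / (1 - ?s))\<^sup>2"
      using that(2) by (simp add: \<sigma>_def power2_eq_square divide_simps) (simp add: algebra_simps)
    moreover have "0 \<le> (1 + ?s) / (1 - ?s)" using that(2) by (simp add: add_nonneg_nonneg)
    ultimately have "sqrt (1 + \<sigma> w \<bullet> \<sigma> w) = (1 + ?s) / (1 - ?s)" by (metis real_sqrt_unique)
    hence "\<rho> (\<sigma> w) = (1 / (1 + (1 + ?s) / (1 - ?s)) * (2 / (1 - ?s))) *\<^sub>R w"
      by (simp add: \<rho>_def \<sigma>_def)
    also have "1 / (1 + (1 + ?s) / (1 - ?s)) * (2 / (1 - ?s)) = 1"
      using that(2) by (simp add: divide_simps)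
    finally show "\<rho> (\<sigma> w) = w" by simp
    show "\<sigma> w \<in> V" using that(1) V by (simp add: \<sigma>_def subspace_scale)
  qed
  have img: "(\<lambda>X. Q (\<rho> X)) ` V = Q ` {w \<in> V. w \<bullet> w < 1}"
  proof
    show "(\<lambda>X. Q (\<rho> X)) ` V \<subseteq> Q ` {w \<in> V. w \<bullet> w < 1}" using rhoV rho1 by auto
    show "Q ` {w \<in> V. w \<bullet> w < 1} \<subseteq> (\<lambda>X. Q (\<rho> X)) ` V"
    proof
      fix z assume "z \<in> Q ` {w \<in> V. w \<bullet> w < 1}"
      then obtain w where "w \<in> V" "w \<bullet> w < 1" "z = Q w" by auto
      thus "z \<in> (\<lambda>X. Q (\<rho> X)) ` V" using sigma[of w] by (auto intro!: image_eqI[of _ _ "\<sigma> w"])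
    qed
  qed
  have ratio: "2 * (h (Q (\<rho> X)) (Q (\<rho> Y)) / (N (Q (\<rho> X)) * N (Q (\<rho> Y)))) - 1 = hyperboloid_form X Y"
    if "X \<in> V" "Y \<in> V" for X Y
  proof -
    define t s where ts: "t = sqrt (1 + X \<bullet> X)" "s = sqrt (1 + Y \<bullet> Y)"
    have t: "1 \<le> t" "X \<bullet> X = t\<^sup>2 - 1" and s: "1 \<le> s" "Y \<bullet> Y = s\<^sup>2 - 1"
      using T[of X] T[of Y] by (simp_all add: ts)
    have "h (Q (\<rho> X)) (Q (\<rho> Y)) / (N (Q (\<rho> X)) * N (Q (\<rho> Y)))
        = 1 + (\<rho> X - \<rho> Y) \<bullet> (\<rho> X - \<rho> Y) / ((1 - \<rho> X \<bullet> \<rho> X) * (1 - \<rho> Y \<bullet> \<rho> Y))"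
    proof -
      have "K\<^sup>2 * (A * B + D) / (K * A * (K * B)) = 1 + D / (A * B)" if "0 < A" "0 < B" for A B D
        using that K by (simp add: power2_eq_square add_divide_distrib distrib_left)
      from this[of "1 - \<rho> X \<bullet> \<rho> X" "1 - \<rho> Y \<bullet> \<rho> Y" "(\<rho> X - \<rho> Y) \<bullet> (\<rho> X - \<rho> Y)"] show ?thesis
        using rho1[of X] rho1[of Y] by (simp add: N QQ rhoV that)
    qed
    also have "\<dots> = 1 + (t * s - 1 - X \<bullet> Y) / 2"
      unfolding rho inner_diff_self unfolding rho2 ts[symmetric] t(2) s(2)
      using t(1) s(1) by (simp add: power2_eq_square divide_simps) (simp add: algebra_simps)
    finally show ?thesis by (simp add: hyperboloid_form_def ts diff_divide_distrib)
  qed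
  have proj: "\<exists>Z\<in>V. \<exists>C. \<forall>X\<in>V.
        h z (Q (\<rho> X)) / (N z * N (Q (\<rho> X))) = C * (h (Q (\<rho> Z)) (Q (\<rho> X)) / (N (Q (\<rho> Z)) * N (Q (\<rho> X))))"
    if z: "z \<in> H" for z
  proof -
    obtain a l c where l: "l \<in> V" and c: "0 \<le> c" and null: "l \<bullet> l = a * c"
      and h: "\<And>w. w \<in> V \<Longrightarrow> h z (Q w) = a + 2 * (l \<bullet> w) + c * (w \<bullet> w)"
      using zQ[OF z] by blast
    have "N z * K * (1 - w \<bullet> w) \<le> a + 2 * (l \<bullet> w) + c * (w \<bullet> w)" if "w \<in> V" "w \<bullet> w < 1" for w
      using ge[OF z QH[OF that]] by (simp add: h N that(1) mult.assoc)
    hence a: "0 < a" "c < a"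
      using null_quadratic_pole[OF V l null c, of "N z * K"] NH[OF z] K by auto
    \<comment> \<open>The zero is \<open>l\<close> divided by \<open>- c\<close>, of squared norm
      \<open>a / c\<close>. Inversion in the unit sphere takes it to \<open>w0\<close>; for
      \<open>c = 0\<close> the zero is at infinity and \<open>w0\<close> is the centre.\<close>
    define w0 where "w0 = (- 1 / a) *\<^sub>R l"
    have w0V: "w0 \<in> V" using V l by (simp add: w0_def subspace_scale subspace_neg)
    have w0: "w0 \<bullet> w0 = c / a" using a null by (simp add: w0_def)
    hence w01: "w0 \<bullet> w0 < 1" using a by simp
    have lw: "l \<bullet> w = - a * (w0 \<bullet> w)" for w using a by (simp add: w0_def)
    have eq: "h z (Q w) = a / K\<^sup>2 * h (Q w0) (Q w)" if "w \<in> V" for w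
      using a K by (simp add: h QQ that w0V inner_diff_self lw w0 field_simps)
    show ?thesis
    proof (intro bexI[of _ "\<sigma> w0"] exI[of _ "a / K\<^sup>2 * N (Q w0) / N z"] ballI)
      fix X assume X: "X \<in> V"
      have "N (Q w0) \<noteq> 0" using NH[OF QH[OF w0V w01]] by simp
      thus "h z (Q (\<rho> X)) / (N z * N (Q (\<rho> X))) = a / K\<^sup>2 * N (Q w0) / N z *
          (h (Q (\<rho> (\<sigma> w0))) (Q (\<rho> X)) / (N (Q (\<rho> (\<sigma> w0))) * N (Q (\<rho> X))))"
        using eq[OF rhoV[OF X]] sigma[OF w0V w01] by simp
    qed (use sigma[OF w0V w01] in simp)
  qed
  show ?thesis
    by (rule exI[of _ "\<lambda>X. Q (\<rho> X)"]) (use img ratio proj in blast)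
qed

text \<open>Completing the square in \<open>N (p u)\<close> shows that the parameters of points in
  \<open>H\<close> fill a Euclidean ball with centre \<open>\<beta>\<close> divided by
  \<open>\<gamma>\<close> and squared radius \<open>\<kappa> / \<gamma>\<^sup>2\<close>. The
  similarity \<open>\<tau>\<close> from the unit ball onto it reduces the claim to
  \<open>ball_chart\<close>.\<close>

lemma affine_chart:
  fixes p :: "'a::real_inner \<Rightarrow> 'p" and N :: "'p \<Rightarrow> real"
  assumes V: "subspace V" "\<beta> \<in> V" and \<gamma>: "0 < \<gamma>"
    and N: "\<And>u. u \<in> V \<Longrightarrow> N (p u) = \<alpha> + 2 * (\<beta> \<bullet> u) - \<gamma> * (u \<bullet> u)"
    and pH: "\<And>u. u \<in> V \<Longrightarrow> p u \<in> H \<longleftrightarrow> 0 < N (p u)"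
    and NH: "\<And>z. z \<in> H \<Longrightarrow> 0 < N z"
    and pp: "\<And>u v. u \<in> V \<Longrightarrow> v \<in> V \<Longrightarrow>
      h (p u) (p v) = N (p u) * N (p v) + (\<alpha> * \<gamma> + \<beta> \<bullet> \<beta>) * ((u - v) \<bullet> (u - v))"
    and zp: "\<And>z. z \<in> H \<Longrightarrow> \<exists>a l c. l \<in> V \<and> 0 \<le> c \<and> l \<bullet> l = a * c \<and>
      (\<forall>u\<in>V. h z (p u) = a + 2 * (l \<bullet> u) + c * (u \<bullet> u))"
    and ge: "\<And>z w. z \<in> H \<Longrightarrow> w \<in> H \<Longrightarrow> N z * N w \<le> h z w"
    and ne: "u0 \<in> V" "p u0 \<in> H"
  shows "\<exists>P. P ` V = p ` V \<inter> H \<and>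
      (\<forall>X\<in>V. \<forall>Y\<in>V. 2 * (h (P X) (P Y) / (N (P X) * N (P Y))) - 1 = hyperboloid_form X Y) \<and>
      (\<forall>z\<in>H. \<exists>Z\<in>V. \<exists>C. \<forall>X\<in>V.
        h z (P X) / (N z * N (P X)) = C * (h (P Z) (P X) / (N (P Z) * N (P X))))"
proof -
  define \<kappa> where "\<kappa> = \<alpha> * \<gamma> + \<beta> \<bullet> \<beta>"
  have gN: "\<gamma> * N (p u) = \<kappa> - (\<gamma> *\<^sub>R u - \<beta>) \<bullet> (\<gamma> *\<^sub>R u - \<beta>)" if "u \<in> V" for u
    by (simp add: N[OF that] \<kappa>_def inner_diff_self algebra_simps inner_commute)
  have \<kappa>: "0 < \<kappa>"
  proof -
    have "0 < \<gamma> * N (p u0)" using NH[OF ne(2)] \<gamma> by simp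
    also have "\<dots> \<le> \<kappa>" using gN[OF ne(1)] by simp
    finally show ?thesis .
  qed
  have sq: "sqrt \<kappa> * (sqrt \<kappa> * r) = \<kappa> * r" for r using \<kappa> by (simp flip: mult.assoc)
  define \<tau> where "\<tau> w = (1 / \<gamma>) *\<^sub>R (\<beta> + sqrt \<kappa> *\<^sub>R w)" for w
  define Q where "Q w = p (\<tau> w)" for w
  have tauV: "\<tau> w \<in> V" if "w \<in> V" for w
    using that V by (simp add: \<tau>_def subspace_add subspace_scale)
  have "\<gamma> *\<^sub>R \<tau> w - \<beta> = sqrt \<kappa> *\<^sub>R w" for w using \<gamma> by (simp add: \<tau>_def)
  hence "(\<gamma> *\<^sub>R \<tau> w - \<beta>) \<bullet> (\<gamma> *\<^sub>R \<tau> w - \<beta>) = \<kappa> * (w \<bullet> w)" for w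
    by (simp add: sq)
  hence NQ: "N (Q w) = \<kappa> / \<gamma> * (1 - w \<bullet> w)" if "w \<in> V" for w
    using gN[OF tauV[OF that]] \<gamma> by (simp add: Q_def field_simps)
  have pos: "0 < N (Q w) \<longleftrightarrow> w \<bullet> w < 1" if "w \<in> V" for w
    using \<gamma> \<kappa> by (simp add: NQ[OF that] zero_less_mult_iff zero_less_divide_iff)
  have tau_surj: "\<exists>w\<in>V. u = \<tau> w" if "u \<in> V" for u
    by (rule bexI[of _ "(1 / sqrt \<kappa>) *\<^sub>R (\<gamma> *\<^sub>R u - \<beta>)"])
      (use that V \<gamma> \<kappa> in \<open>auto simp: \<tau>_def intro!: subspace_scale subspace_diff\<close>)
  have img: "Q ` {w \<in> V. w \<bullet> w < 1} = p ` V \<inter> H"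
  proof
    show "Q ` {w \<in> V. w \<bullet> w < 1} \<subseteq> p ` V \<inter> H"
      using pos tauV pH by (auto simp: Q_def)
    show "p ` V \<inter> H \<subseteq> Q ` {w \<in> V. w \<bullet> w < 1}"
    proof
      fix z assume "z \<in> p ` V \<inter> H"
      then obtain u where u: "u \<in> V" "z = p u" "p u \<in> H" by auto
      obtain w where "w \<in> V" "u = \<tau> w" using tau_surj[OF u(1)] by blast
      thus "z \<in> Q ` {w \<in> V. w \<bullet> w < 1}"
        using pos[of w] u pH[OF u(1)] by (auto simp: Q_def)
    qed
  qed
  show ?thesis
    unfolding img[symmetric]
  proof (rule ball_chart[where K = "\<kappa> / \<gamma>"])
    show "subspace V" "0 < \<kappa> / \<gamma>" using V \<gamma> \<kappa> by auto
    show "N (Q w) = \<kappa> / \<gamma> * (1 - w \<bullet> w)" if "w \<in> V" for w using NQ[OF that] .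
    show "Q w \<in> H" if "w \<in> V" "w \<bullet> w < 1" for w using img that by blast
    show "h (Q w) (Q v) = (\<kappa> / \<gamma>)\<^sup>2 * ((1 - w \<bullet> w) * (1 - v \<bullet> v) + (w - v) \<bullet> (w - v))"
      if "w \<in> V" "v \<in> V" for w v
    proof -
      have "\<tau> w - \<tau> v = (sqrt \<kappa> / \<gamma>) *\<^sub>R (w - v)" by (simp add: \<tau>_def algebra_simps)
      hence "(\<tau> w - \<tau> v) \<bullet> (\<tau> w - \<tau> v) = \<kappa> / \<gamma>\<^sup>2 * ((w - v) \<bullet> (w - v))"
        using \<kappa> by (simp add: power2_eq_square)
      moreover have "h (Q w) (Q v) = N (Q w) * N (Q v) + \<kappa> * ((\<tau> w - \<tau> v) \<bullet> (\<tau> w - \<tau> v))"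
        using pp[OF tauV[OF that(1)] tauV[OF that(2)]] by (simp add: Q_def \<kappa>_def)
      ultimately have "h (Q w) (Q v) = \<kappa> / \<gamma> * (1 - w \<bullet> w) * (\<kappa> / \<gamma> * (1 - v \<bullet> v)) +
          \<kappa> * (\<kappa> / \<gamma>\<^sup>2 * ((w - v) \<bullet> (w - v)))"
        by (simp add: NQ that)
      also have "\<dots> = (\<kappa> / \<gamma>)\<^sup>2 * ((1 - w \<bullet> w) * (1 - v \<bullet> v) + (w - v) \<bullet> (w - v))"
        by (simp add: power2_eq_square distrib_left mult_ac)
      finally show ?thesis .
    qed
    show "\<exists>a l c. l \<in> V \<and> 0 \<le> c \<and> l \<bullet> l = a * c \<and>
      (\<forall>w\<in>V. h z (Q w) = a + 2 * (l \<bullet> w) + c * (w \<bullet> w))" if z: "z \<in> H" for z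
    proof -
      obtain a l c where l: "l \<in> V" and c: "0 \<le> c" and null: "l \<bullet> l = a * c"
        and h: "\<And>u. u \<in> V \<Longrightarrow> h z (p u) = a + 2 * (l \<bullet> u) + c * (u \<bullet> u)"
        using zp[OF z] by blast
      \<comment> \<open>Coefficients of the quadratic after substituting \<open>\<tau>\<close>. The
        linear part of \<open>\<tau>\<close> is a scalar, so the leading part stays a multiple of
        \<open>w \<bullet> w\<close> and the discriminant stays zero.\<close>
      let ?a = "a + 2 * (l \<bullet> \<beta>) / \<gamma> + c * (\<beta> \<bullet> \<beta>) / \<gamma>\<^sup>2"
      let ?l = "(sqrt \<kappa> / \<gamma>) *\<^sub>R (l + (c / \<gamma>) *\<^sub>R \<beta>)"
      let ?c = "c * \<kappa> / \<gamma>\<^sup>2"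
      have "?l \<bullet> ?l = \<kappa> / \<gamma>\<^sup>2 * (a * c + 2 * (c / \<gamma>) * (l \<bullet> \<beta>) + (c / \<gamma>)\<^sup>2 * (\<beta> \<bullet> \<beta>))"
        using \<kappa> null by (simp add: inner_add inner_commute power2_eq_square algebra_simps sq)
      also have "\<dots> = ?a * ?c" using \<gamma> by (simp add: power2_eq_square field_simps)
      finally have null': "?l \<bullet> ?l = ?a * ?c" .
      have h': "h z (Q w) = ?a + 2 * (?l \<bullet> w) + ?c * (w \<bullet> w)" if "w \<in> V" for w
      proof -
        have tt: "\<tau> w \<bullet> \<tau> w = (\<beta> \<bullet> \<beta> + 2 * sqrt \<kappa> * (\<beta> \<bullet> w) + \<kappa> * (w \<bullet> w)) / \<gamma>\<^sup>2"
          by (simp add: \<tau>_def inner_add inner_commute power2_eq_square add_divide_distrib algebra_simps sq)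
        have lt: "l \<bullet> \<tau> w = (l \<bullet> \<beta> + sqrt \<kappa> * (l \<bullet> w)) / \<gamma>" by (simp add: \<tau>_def inner_add)
        show ?thesis
          unfolding Q_def h[OF tauV[OF that]] tt lt
          by (simp add: inner_add power2_eq_square add_divide_distrib algebra_simps)
      qed
      show ?thesis
        by (intro exI[of _ ?a] exI[of _ ?l] exI[of _ ?c] conjI ballI h' null')
          (use V l c \<kappa> in \<open>auto intro!: subspace_scale subspace_add\<close>)
    qed
  qed (use NH ge in auto)
qed

section \<open>The Hermitian form of hyperbolic space\<close>

definition hyp_norm :: "nat \<Rightarrow> (nat \<Rightarrow> oct) \<Rightarrow> real" where
  "hyp_norm k x = 1 - (\<Sum>i<k. x i \<bullet> x i)"

lemma hyp_space_iff:
  "x \<in> hyp_space F k \<longleftrightarrow> (\<forall>i<k. x i \<in> scalars F) \<and> (\<forall>i\<ge>k. x i = 0) \<and> 0 < hyp_norm k x"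
  by (auto simp: hyp_space_def hyp_norm_def power2_norm_eq_inner)

lemma hyp_norm_pos: "x \<in> hyp_space F k \<Longrightarrow> 0 < hyp_norm k x"
  by (simp add: hyp_space_iff)

lemma hyp_dist_eq: "hyp_dist k x y = arcosh (sqrt (hyp_form k x y / (hyp_norm k x * hyp_norm k y)))"
  by (simp add: hyp_dist_def hyp_norm_def power2_norm_eq_inner)

lemma hyp_form_commute: "hyp_form k x y = hyp_form k y x"
  by (simp add: hyp_form_def inner_commute)

lemma hyp_dist_commute: "hyp_dist k x y = hyp_dist k y x"
  by (simp add: hyp_dist_eq hyp_form_commute mult.commute)

lemma norm_one_minus_square:
  "(norm (oct_one - a))\<^sup>2 \<ge> (1 - oct_one \<bullet> a)\<^sup>2"
proof -
  have "\<bar>oct_one \<bullet> (oct_one - a)\<bar> \<le> norm oct_one * norm (oct_one - a)"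
    by (rule Cauchy_Schwarz_ineq2)
  hence "\<bar>1 - oct_one \<bullet> a\<bar> \<le> norm (oct_one - a)"
    by (simp add: inner_diff norm_eq_sqrt_inner[of oct_one])
  thus ?thesis by (metis abs_ge_zero power2_abs power_mono)
qed

lemma oct_one_inner_mult: "oct_one \<bullet> (oct_cnj a \<odot> b) = a \<bullet> b"
  by (metis inner_commute oct_cnj_cnj oct_mult_adjoint_left oct_one_mult(2))

lemma hyp_form_eq_norm_square:
  assumes "F \<noteq> Octonion_alg" "\<And>i. i < k \<Longrightarrow> x i \<in> scalars F" "\<And>i. i < k \<Longrightarrow> y i \<in> scalars F"
  shows "hyp_form k x y = (norm (oct_one - (\<Sum>i<k. oct_cnj (x i) \<odot> y i)))\<^sup>2"
proof -
  have "scalars F \<subseteq> scalars Quaternion_alg" using assms(1) by (cases F) auto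
  thus ?thesis using hyp_form_associative[of k x y] assms unfolding oct_one_def by blast
qed

lemma oct_mult_self_cnj: "a \<odot> oct_cnj a = (a \<bullet> a) *\<^sub>R oct_one"
  using oct_mult_cnj_right[of oct_one a] by simp

text \<open>The two mixed terms of the double sum agree because conjugation is an isometry that
  reverses products.\<close>

lemma hyp_form_2:
  "hyp_form 2 x y = 1 - 2 * (x 0 \<bullet> y 0 + x 1 \<bullet> y 1)
     + (x 0 \<bullet> x 0) * (y 0 \<bullet> y 0) + (x 1 \<bullet> x 1) * (y 1 \<bullet> y 1)
     + 2 * ((x 0 \<odot> oct_cnj (x 1)) \<bullet> (y 0 \<odot> oct_cnj (y 1)))"
proof -
  have "(a \<odot> oct_cnj b) \<bullet> (c \<odot> oct_cnj d) = (b \<odot> oct_cnj a) \<bullet> (d \<odot> oct_cnj c)" for a b c d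
    by (metis oct_cnj_cnj oct_cnj_inner oct_cnj_mult)
  from this[of "x 1" "x 0" "y 1" "y 0"] show ?thesis
    by (simp add: hyp_form_def numeral_2_eq_2 oct_mult_self_cnj)
qed

text \<open>Lack of associativity is harmless because the coordinates of a single vector can be written as
  \<open>(s \<odot> t, r *\<^sub>R t)\<close> with \<open>r\<close> real, and then only alternativity is needed.\<close>

lemma hyp_form_2_factor:
  assumes "x 0 = s \<odot> t" "x 1 = r *\<^sub>R t"
  shows "hyp_form 2 x y = (norm (oct_one - oct_cnj t \<odot> (oct_cnj s \<odot> y 0 + r *\<^sub>R y 1)))\<^sup>2"
proof -
  let ?w = "oct_cnj s \<odot> y 0 + r *\<^sub>R y 1"
  have 1: "t \<bullet> ?w = x 0 \<bullet> y 0 + x 1 \<bullet> y 1"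
    by (simp add: assms inner_add oct_mult_adjoint_left del: One_nat_def)
  have 2: "?w \<bullet> ?w = (s \<bullet> s) * (y 0 \<bullet> y 0) + r\<^sup>2 * (y 1 \<bullet> y 1) + 2 * r * (y 1 \<bullet> (oct_cnj s \<odot> y 0))"
    by (simp add: inner_add oct_mult_inner_same oct_cnj_inner inner_commute power2_eq_square algebra_simps)
  have "x 0 \<odot> oct_cnj (x 1) = (r * (t \<bullet> t)) *\<^sub>R s"
    by (simp add: assms linear_scale[OF linear_oct_cnj] oct_mult.scaleR_right oct_mult_cnj_right
        del: One_nat_def)
  moreover have "s \<bullet> (y 0 \<odot> oct_cnj (y 1)) = y 1 \<bullet> (oct_cnj s \<odot> y 0)"
    by (metis oct_mult_adjoint_left oct_mult_adjoint_right)
  ultimately have 3: "(x 0 \<odot> oct_cnj (x 1)) \<bullet> (y 0 \<odot> oct_cnj (y 1)) = r * (t \<bullet> t) * (y 1 \<bullet> (oct_cnj s \<odot> y 0))"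
    by simp
  have "(norm (oct_one - oct_cnj t \<odot> ?w))\<^sup>2 = 1 - 2 * (t \<bullet> ?w) + (t \<bullet> t) * (?w \<bullet> ?w)"
    unfolding power2_norm_eq_inner inner_diff_self
    by (simp add: oct_one_inner_mult oct_mult_inner_same oct_cnj_inner)
  also have "\<dots> = hyp_form 2 x y"
    unfolding hyp_form_2 3 1 2
    by (simp add: assms oct_mult_inner_same power2_eq_square algebra_simps del: One_nat_def)
  finally show ?thesis by simp
qed

text \<open>For \<open>b \<noteq> 0\<close> take \<open>t = b\<close> and for \<open>s\<close> the
  right quotient of \<open>a\<close> by \<open>b\<close>; for \<open>b = 0\<close> take
  \<open>s\<close> to be the unit and \<open>r = 0\<close>.\<close>

lemma oct_pair_factor:
  fixes a b :: oct
  obtains s t r where "a = s \<odot> t" "b = r *\<^sub>R t"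
proof (cases "b = 0")
  case True
  thus thesis using that[of oct_one a 0] by simp
next
  case False
  have "((1 / (b \<bullet> b)) *\<^sub>R (a \<odot> oct_cnj b)) \<odot> b = a"
    using False oct_mult_cnj_right[of a "oct_cnj b"]
    by (simp add: oct_mult.scaleR_left oct_cnj_inner)
  from that[OF this[symmetric], of 1] show thesis by simp
qed

text \<open>In the associative and in the octonionic case alike, the form is the squared norm of a
  number with real part \<open>1 - (\<Sum>i<k. x i \<bullet> y i)\<close>.\<close>

lemma hyp_form_ge_inner:
  assumes "F = Octonion_alg \<Longrightarrow> k = 2" "x \<in> hyp_space F k" "y \<in> hyp_space F k"
  shows "(1 - (\<Sum>i<k. x i \<bullet> y i))\<^sup>2 \<le> hyp_form k x y"
proof (cases "F = Octonion_alg")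
  case False
  hence "hyp_form k x y = (norm (oct_one - (\<Sum>i<k. oct_cnj (x i) \<odot> y i)))\<^sup>2"
    using assms by (intro hyp_form_eq_norm_square) (auto simp: hyp_space_iff)
  thus ?thesis
    using norm_one_minus_square[of "\<Sum>i<k. oct_cnj (x i) \<odot> y i"]
    by (simp add: inner_sum_right oct_one_inner_mult)
next
  case True
  obtain s t r where st: "x 0 = s \<odot> t" "x 1 = r *\<^sub>R t" by (rule oct_pair_factor)
  have "oct_one \<bullet> (oct_cnj t \<odot> (oct_cnj s \<odot> y 0 + r *\<^sub>R y 1)) = x 0 \<bullet> y 0 + x 1 \<bullet> y 1"
    by (simp add: oct_one_inner_mult st inner_add oct_mult_adjoint_left del: One_nat_def)
  moreover have "(\<Sum>i<k. x i \<bullet> y i) = x 0 \<bullet> y 0 + x 1 \<bullet> y 1"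
    using assms(1) True by (simp add: numeral_2_eq_2)
  ultimately show ?thesis
    using norm_one_minus_square[of "oct_cnj t \<odot> (oct_cnj s \<odot> y 0 + r *\<^sub>R y 1)"]
      hyp_form_2_factor[OF st, of y] assms(1) True by simp
qed

text \<open>A reversed Cauchy-Schwarz inequality with an explicit gap. The real part is half of
  \<open>hyp_norm k x + hyp_norm k y + D\<close> with \<open>D\<close> the squared Euclidean
  distance, so comparing arithmetic and geometric mean leaves \<open>(D / 2)\<^sup>2\<close> to
  spare.\<close>

lemma hyp_form_ge:
  assumes "F = Octonion_alg \<Longrightarrow> k = 2" "x \<in> hyp_space F k" "y \<in> hyp_space F k"
  shows "hyp_norm k x * hyp_norm k y \<le> hyp_form k x y"
    and "hyp_form k x y = hyp_norm k x * hyp_norm k y \<Longrightarrow> x = y"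
proof -
  define D where "D = (\<Sum>i<k. (x i - y i) \<bullet> (x i - y i))"
  let ?N = "hyp_norm k x" and ?M = "hyp_norm k y"
  have D: "0 \<le> D" by (auto simp: D_def intro: sum_nonneg)
  have pos: "0 < ?N" "0 < ?M" using assms by (auto simp: hyp_norm_pos)
  have eq: "1 - (\<Sum>i<k. x i \<bullet> y i) = (?N + ?M + D) / 2"
    by (simp add: hyp_norm_def D_def inner_diff_self sum.distrib sum_subtractf sum_distrib_left[symmetric])
  have "((?N + ?M + D) / 2)\<^sup>2 \<le> hyp_form k x y"
    using hyp_form_ge_inner[OF assms] by (simp only: eq)
  moreover have "((?N + ?M + D) / 2)\<^sup>2 = ?N * ?M + ((?N - ?M) / 2)\<^sup>2 + (D / 2)\<^sup>2 + (?N + ?M) * D / 2"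
    by (simp add: power2_eq_square field_simps)
  moreover have "0 \<le> (?N + ?M) * D / 2" using pos D by simp
  ultimately have ge: "?N * ?M + (D / 2)\<^sup>2 \<le> hyp_form k x y"
    using zero_le_power2[of "(?N - ?M) / 2"] by linarith
  show "?N * ?M \<le> hyp_form k x y" using ge zero_le_power2[of "D / 2"] by linarith
  assume "hyp_form k x y = ?N * ?M"
  hence "(D / 2)\<^sup>2 \<le> 0" using ge by linarith
  hence "D = 0" by simp
  hence "\<forall>i<k. x i = y i" unfolding D_def by (subst (asm) sum_nonneg_eq_0_iff) auto
  moreover have "\<forall>i\<ge>k. x i = y i" using assms by (auto simp: hyp_space_iff)
  ultimately show "x = y" by (metis ext linorder_not_le)
qed

lemma hyp_form_self:
  assumes "F = Octonion_alg \<Longrightarrow> k = 2" "x \<in> hyp_space F k"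
  shows "hyp_form k x x = (hyp_norm k x)\<^sup>2"
proof (cases "F = Octonion_alg")
  case False
  have "oct_cnj a \<odot> a = (a \<bullet> a) *\<^sub>R oct_one" for a
    using oct_mult_cnj_left[of a oct_one] by simp
  moreover have "hyp_form k x x = (norm (oct_one - (\<Sum>i<k. oct_cnj (x i) \<odot> x i)))\<^sup>2"
    using False assms by (intro hyp_form_eq_norm_square) (auto simp: hyp_space_iff)
  ultimately have "hyp_form k x x = (norm (oct_one - (\<Sum>i<k. x i \<bullet> x i) *\<^sub>R oct_one))\<^sup>2"
    by (simp add: scaleR_left.sum)
  also have "oct_one - (\<Sum>i<k. x i \<bullet> x i) *\<^sub>R oct_one = hyp_norm k x *\<^sub>R oct_one"
    by (simp add: hyp_norm_def algebra_simps)
  finally show ?thesis by (simp add: power_mult_distrib norm_eq_sqrt_inner[of oct_one])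
next
  case True
  hence k: "k = 2" using assms by simp
  show ?thesis
    unfolding k hyp_form_2
    by (simp add: hyp_norm_def numeral_2_eq_2 oct_mult_inner_same oct_cnj_inner power2_eq_square algebra_simps)
qed

text \<open>The quotient is at least 1, so \<open>arcosh\<close> is taken inside its domain;
  squaring removes the root in \<open>hyp_dist\<close>.\<close>

lemma cosh_hyp_dist:
  assumes "F = Octonion_alg \<Longrightarrow> k = 2" "x \<in> hyp_space F k" "y \<in> hyp_space F k"
  shows "(cosh (hyp_dist k x y))\<^sup>2 = hyp_form k x y / (hyp_norm k x * hyp_norm k y)"
    and "0 \<le> hyp_dist k x y"
proof -
  have "1 \<le> hyp_form k x y / (hyp_norm k x * hyp_norm k y)"
    using hyp_form_ge(1)[OF assms] hyp_norm_pos[OF assms(2)] hyp_norm_pos[OF assms(3)] by simp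
  hence "1 \<le> sqrt (hyp_form k x y / (hyp_norm k x * hyp_norm k y))" (is "1 \<le> ?c") by simp
  moreover from this have "?c\<^sup>2 = hyp_form k x y / (hyp_norm k x * hyp_norm k y)"
    by (intro real_sqrt_pow2) (smt (verit) real_sqrt_lt_0_iff)
  ultimately show "(cosh (hyp_dist k x y))\<^sup>2 = hyp_form k x y / (hyp_norm k x * hyp_norm k y)"
    and "0 \<le> hyp_dist k x y"
    unfolding hyp_dist_eq by (simp_all add: cosh_arcosh_real)
qed

section \<open>Existence of lines over each algebra\<close>

text \<open>The doubled distance is that of the hyperboloid of curvature \<open>-1\<close>; over the reals the line is
  one-dimensional and the factor only rescales the parameter.\<close>

definition F_line_chart :: "division_algebra \<Rightarrow> nat \<Rightarrow> (oct \<Rightarrow> nat \<Rightarrow> oct) \<Rightarrow> bool" where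
  "F_line_chart F k P \<longleftrightarrow>
     (\<forall>X\<in>scalars F. \<forall>Y\<in>scalars F. cosh (2 * hyp_dist k (P X) (P Y)) = hyperboloid_form X Y) \<and>
     pythagorean (hyp_space F k) (hyp_dist k) (P ` scalars F)"

lemma semimetric_hyp:
  assumes "F = Octonion_alg \<Longrightarrow> k = 2"
  shows "semimetric_on (hyp_space F k) (hyp_dist k)"
  unfolding semimetric_on_def
proof (intro ballI conjI)
  fix x y assume xy: "x \<in> hyp_space F k" "y \<in> hyp_space F k"
  show nn: "0 \<le> hyp_dist k x y" by (rule cosh_hyp_dist(2)[OF assms xy])
  show "hyp_dist k x y = hyp_dist k y x" by (rule hyp_dist_commute)
  have pos: "0 < hyp_norm k x" "0 < hyp_norm k y" using xy by (simp_all add: hyp_norm_pos)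
  show "hyp_dist k x y = 0 \<longleftrightarrow> x = y"
  proof
    assume "hyp_dist k x y = 0"
    hence "hyp_form k x y = hyp_norm k x * hyp_norm k y"
      using cosh_hyp_dist(1)[OF assms xy] pos by simp
    thus "x = y" using hyp_form_ge(2)[OF _ xy] assms by blast
  next
    assume "x = y"
    hence "(cosh (hyp_dist k x y))\<^sup>2 = 1"
      using cosh_hyp_dist(1)[OF assms xy] hyp_form_self[OF assms xy(2)] pos by (simp add: power2_eq_square)
    hence "cosh (hyp_dist k x y) = cosh 0"
      using cosh_real_pos[of "hyp_dist k x y"] by (simp add: power2_eq_1_iff)
    thus "hyp_dist k x y = 0" using cosh_real_nonneg_eq_iff[OF nn, of 0] by simp
  qed
qed

text \<open>Translates \<open>affine_chart\<close> into distances. The doubling formula for cosh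
  accounts for \<open>cosh (2 * d)\<close>, and evaluating the proportionality at the foot itself
  identifies its factor as the squared cosh of the distance to the foot.\<close>

lemma F_line_chartI:
  assumes k: "F = Octonion_alg \<Longrightarrow> k = 2"
    and V: "subspace V" "V = scalars F" "\<beta> \<in> V" and \<gamma>: "0 < \<gamma>"
    and N: "\<And>u. u \<in> V \<Longrightarrow> hyp_norm k (p u) = \<alpha> + 2 * (\<beta> \<bullet> u) - \<gamma> * (u \<bullet> u)"
    and pH: "\<And>u i. u \<in> V \<Longrightarrow> i < k \<Longrightarrow> p u i \<in> V" "\<And>u i. k \<le> i \<Longrightarrow> p u i = 0"
    and pp: "\<And>u v. u \<in> V \<Longrightarrow> v \<in> V \<Longrightarrow> hyp_form k (p u) (p v) =
      hyp_norm k (p u) * hyp_norm k (p v) + (\<alpha> * \<gamma> + \<beta> \<bullet> \<beta>) * ((u - v) \<bullet> (u - v))"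
    and zp: "\<And>z. z \<in> hyp_space F k \<Longrightarrow> \<exists>a l c. l \<in> V \<and> 0 \<le> c \<and> l \<bullet> l = a * c \<and>
      (\<forall>u\<in>V. hyp_form k z (p u) = a + 2 * (l \<bullet> u) + c * (u \<bullet> u))"
    and xy: "x \<in> p ` V \<inter> hyp_space F k" "y \<in> p ` V \<inter> hyp_space F k"
  shows "\<exists>P. F_line_chart F k P \<and> x \<in> P ` V \<and> y \<in> P ` V"
proof -
  let ?H = "hyp_space F k" and ?d = "hyp_dist k"
  let ?r = "\<lambda>z w. hyp_form k z w / (hyp_norm k z * hyp_norm k w)"
  obtain u0 where u0: "u0 \<in> V" "p u0 \<in> ?H" using xy(1) by auto
  have "p u \<in> ?H \<longleftrightarrow> 0 < hyp_norm k (p u)" if "u \<in> V" for u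
    using pH that V(2) by (auto simp: hyp_space_iff)
  from affine_chart[where h = "hyp_form k" and N = "hyp_norm k" and p = p and H = ?H,
      OF V(1,3) \<gamma> N this hyp_norm_pos pp zp hyp_form_ge(1)[OF k] u0]
  obtain P where "P ` V = p ` V \<inter> ?H \<and>
      (\<forall>X\<in>V. \<forall>Y\<in>V. 2 * ?r (P X) (P Y) - 1 = hyperboloid_form X Y) \<and>
      (\<forall>z\<in>?H. \<exists>Z\<in>V. \<exists>C. \<forall>X\<in>V. ?r z (P X) = C * ?r (P Z) (P X))"
    by (rule exE)
  hence P: "P ` V = p ` V \<inter> ?H"
    and form: "\<And>X Y. X \<in> V \<Longrightarrow> Y \<in> V \<Longrightarrow> 2 * ?r (P X) (P Y) - 1 = hyperboloid_form X Y"
    and proj: "\<And>z. z \<in> ?H \<Longrightarrow> \<exists>Z\<in>V. \<exists>C. \<forall>X\<in>V. ?r z (P X) = C * ?r (P Z) (P X)"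
    by simp_all
  have PH: "P X \<in> ?H" if "X \<in> V" for X using P that by blast
  have cosh2: "(cosh (?d z w))\<^sup>2 = ?r z w" if "z \<in> ?H" "w \<in> ?H" for z w
    by (rule cosh_hyp_dist(1)[OF k that])
  have "\<exists>w C. foot ?d (P ` V) z w C" if z: "z \<in> ?H" for z
  proof -
    obtain Z C where Z: "Z \<in> V" and C: "\<And>X. X \<in> V \<Longrightarrow> ?r z (P X) = C * ?r (P Z) (P X)"
      using proj[OF z] by blast
    have d0: "?d (P Z) (P Z) = 0"
      using semimetric_hyp[OF k] PH[OF Z] by (auto simp: semimetric_on_def)
    have "(cosh (?d z (P Z)))\<^sup>2 = C * (cosh (?d (P Z) (P Z)))\<^sup>2"
      unfolding cosh2[OF z PH[OF Z]] cosh2[OF PH[OF Z] PH[OF Z]] by (rule C[OF Z])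
    hence CZ: "C = (cosh (?d z (P Z)))\<^sup>2" by (simp add: d0)
    have "foot ?d (P ` V) z (P Z) (cosh (?d z (P Z)))"
      unfolding foot_def
    proof (intro conjI ballI impI)
      fix w assume "w \<in> P ` V"
      then obtain X where X: "X \<in> V" "w = P X" by auto
      have "(cosh (?d z w))\<^sup>2 = (cosh (?d z (P Z)) * cosh (?d (P Z) w))\<^sup>2"
        using C[OF X(1)] cosh2[OF z PH[OF X(1)]] cosh2[OF PH[OF Z] PH[OF X(1)]] CZ X(2)
        by (simp add: power_mult_distrib)
      thus "cosh (?d z w) = cosh (?d z (P Z)) * cosh (?d (P Z) w)"
        by (rule power2_eq_imp_eq) auto
    next
      assume "cosh (?d z (P Z)) = 1"
      hence "?d z (P Z) = 0"
        using cosh_real_nonneg_eq_iff[OF cosh_hyp_dist(2)[OF k z PH[OF Z]], of 0] by simp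
      thus "P Z = z" using semimetric_hyp[OF k] z PH[OF Z] by (auto simp: semimetric_on_def)
    qed (use Z cosh_real_ge_1 in auto)
    thus ?thesis by blast
  qed
  hence "pythagorean ?H ?d (P ` V)" using PH by (auto simp: pythagorean_def)
  moreover have "cosh (2 * ?d (P X) (P Y)) = hyperboloid_form X Y" if "X \<in> V" "Y \<in> V" for X Y
    using form[OF that] cosh2[OF PH[OF that(1)] PH[OF that(2)]] by (simp add: cosh_double_cosh)
  ultimately have "F_line_chart F k P" using V(2) by (auto simp: F_line_chart_def)
  thus ?thesis using xy P by blast
qed

section \<open>Lines over the associative algebras\<close>

lemma oct_mult_inner_right_same: "(u \<odot> a) \<bullet> (v \<odot> a) = (a \<bullet> a) * (u \<bullet> v)"
  by (simp add: oct_mult_adjoint_right[of u a] oct_mult_cnj_right)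

lemma oct_mult_inner_left_same: "(a \<odot> u) \<bullet> (a \<odot> v) = (a \<bullet> a) * (u \<bullet> v)"
  by (simp add: oct_mult_adjoint_left[of a u] oct_mult_cnj_left)

lemma oct_cnj_mult_self: "oct_cnj a \<odot> a = (a \<bullet> a) *\<^sub>R oct_one"
  using oct_mult_cnj_left[of a oct_one] by simp

text \<open>Scalars act on the right of the direction \<open>q\<close>, so associativity pulls
  \<open>u\<close> out of the sums over coordinates and leaves \<open>hyp_form k z (p u)\<close> as
  the squared norm of an expression affine in \<open>u\<close>.\<close>

lemma F_line_chart_associative:
  assumes F: "F \<noteq> Octonion_alg" and x: "x \<in> hyp_space F k" and y: "y \<in> hyp_space F k" and "x \<noteq> y"
  shows "\<exists>P. F_line_chart F k P \<and> x \<in> P ` scalars F \<and> y \<in> P ` scalars F"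
proof -
  let ?V = "scalars F"
  note V = subspace_scalars[of F]
  have xV: "x i \<in> ?V" "y i \<in> ?V" for i
    using x y V by (auto simp: hyp_space_iff not_less subspace_0 intro: linorder_cases[of i k])
  obtain j where j: "x j \<noteq> y j" using \<open>x \<noteq> y\<close> by (auto simp: fun_eq_iff)
  hence jk: "j < k" using x y by (metis hyp_space_iff linorder_not_less)
  define \<delta> where "\<delta> = y j - x j"
  \<comment> \<open>The direction \<open>y - x\<close> is divided on the right by its nonzero entry
    \<open>\<delta>\<close>; this makes its entry at \<open>j\<close> the unit and puts
    \<open>y\<close> at parameter \<open>\<delta>\<close>.\<close>
  define q where "q i = (y i - x i) \<odot> ((1 / (\<delta> \<bullet> \<delta>)) *\<^sub>R oct_cnj \<delta>)" for i
  define p where "p u = (\<lambda>i. x i + q i \<odot> u)" for u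
  have \<delta>: "\<delta> \<in> ?V" "\<delta> \<bullet> \<delta> \<noteq> 0" using xV V j by (auto simp: \<delta>_def subspace_diff)
  have qV: "q i \<in> ?V" for i
    using xV V \<delta> by (auto simp: q_def intro!: scalars_mult subspace_scale subspace_diff scalars_cnj)
  have qj: "q j = oct_one" using \<delta> by (simp add: q_def \<delta>_def[symmetric] oct_mult.scaleR_right oct_mult_self_cnj)
  have p0: "p 0 = x" by (simp add: p_def oct_mult.zero_right)
  have p1: "p \<delta> = y"
    using \<delta> oct_mult_cnj_right[of _ "oct_cnj \<delta>"]
    by (simp add: p_def q_def oct_mult.scaleR_right oct_mult.scaleR_left oct_cnj_inner)
  note assoc = oct_mult_assoc[OF scalars_snd[OF _ F] scalars_snd[OF _ F] scalars_snd[OF _ F]]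
  define \<alpha> where "\<alpha> = hyp_norm k x"
  define \<beta> where "\<beta> = - (\<Sum>i<k. oct_cnj (q i) \<odot> x i)"
  define \<gamma> where "\<gamma> = (\<Sum>i<k. q i \<bullet> q i)"
  have \<beta>: "\<beta> \<in> ?V"
    unfolding \<beta>_def using V xV qV by (intro subspace_neg subspace_sum scalars_mult scalars_cnj)
  have "q j \<bullet> q j \<le> \<gamma>" unfolding \<gamma>_def by (rule member_le_sum) (use jk in auto)
  hence \<gamma>: "0 < \<gamma>" by (simp add: qj)
  have N: "hyp_norm k (p u) = \<alpha> + 2 * (\<beta> \<bullet> u) - \<gamma> * (u \<bullet> u)" for u
  proof -
    have "(\<Sum>i<k. p u i \<bullet> p u i) = (\<Sum>i<k. x i \<bullet> x i + 2 * ((oct_cnj (q i) \<odot> x i) \<bullet> u) + (q i \<bullet> q i) * (u \<bullet> u))"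
    proof (rule sum.cong)
      fix i
      have "(q i \<odot> u) \<bullet> x i = (oct_cnj (q i) \<odot> x i) \<bullet> u"
        by (metis inner_commute oct_mult_adjoint_left)
      thus "p u i \<bullet> p u i = x i \<bullet> x i + 2 * ((oct_cnj (q i) \<odot> x i) \<bullet> u) + (q i \<bullet> q i) * (u \<bullet> u)"
        by (simp add: p_def inner_add oct_mult_inner_same inner_commute[of "x i" "q i \<odot> u"])
    qed simp
    also have "\<dots> = (\<Sum>i<k. x i \<bullet> x i) - 2 * (\<beta> \<bullet> u) + \<gamma> * (u \<bullet> u)"
      by (simp add: sum.distrib \<beta>_def \<gamma>_def inner_sum_left sum_distrib_left sum_distrib_right)
    finally show ?thesis by (simp add: hyp_norm_def \<alpha>_def)
  qed
  have pV: "p u i \<in> ?V" if "u \<in> ?V" for u i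
    using that V xV qV by (simp add: p_def subspace_add scalars_mult)
  show ?thesis
  proof (rule F_line_chartI[where p = p, OF _ V refl \<beta> \<gamma> N])
    show "F = Octonion_alg \<Longrightarrow> k = 2" using F by simp
    show "p u i \<in> ?V" if "u \<in> ?V" for u i using pV[OF that] .
    show "p u i = 0" if "k \<le> i" for u i
      using that x y by (simp add: p_def q_def hyp_space_iff oct_mult.zero_left)
    show "x \<in> p ` ?V \<inter> hyp_space F k" using p0 x V by (metis IntI imageI subspace_0)
    show "y \<in> p ` ?V \<inter> hyp_space F k" using p1 y \<delta>(1) by blast
    show "\<exists>a l c. l \<in> ?V \<and> 0 \<le> c \<and> l \<bullet> l = a * c \<and>
        (\<forall>u\<in>?V. hyp_form k z (p u) = a + 2 * (l \<bullet> u) + c * (u \<bullet> u))" if "z \<in> hyp_space F k" for z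
    proof -
      have z: "z i \<in> ?V" if "i < k" for i using \<open>z \<in> hyp_space F k\<close> that by (simp add: hyp_space_iff)
      define A where "A = oct_one - (\<Sum>i<k. oct_cnj (z i) \<odot> x i)"
      define B where "B = (\<Sum>i<k. oct_cnj (z i) \<odot> q i)"
      have "A \<in> ?V" unfolding A_def using V xV z
        by (intro subspace_diff subspace_sum scalars_mult scalars_cnj scalars_one) auto
      moreover have "B \<in> ?V" unfolding B_def using V qV z
        by (intro subspace_sum scalars_mult scalars_cnj) auto
      ultimately have "- (oct_cnj B \<odot> A) \<in> ?V"
        using V by (intro subspace_neg scalars_mult scalars_cnj)
      moreover have "hyp_form k z (p u) = A \<bullet> A + 2 * (- (oct_cnj B \<odot> A) \<bullet> u) + (B \<bullet> B) * (u \<bullet> u)"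
        if u: "u \<in> ?V" for u
      proof -
        have "(\<Sum>i<k. oct_cnj (z i) \<odot> p u i) = (\<Sum>i<k. oct_cnj (z i) \<odot> x i + (oct_cnj (z i) \<odot> q i) \<odot> u)"
          by (intro sum.cong refl) (simp add: p_def oct_mult.add_right assoc z qV u scalars_cnj)
        also have "\<dots> = (\<Sum>i<k. oct_cnj (z i) \<odot> x i) + B \<odot> u"
          by (simp add: sum.distrib B_def oct_mult.sum_left)
        finally have "oct_one - (\<Sum>i<k. oct_cnj (z i) \<odot> p u i) = A - B \<odot> u"
          by (simp add: A_def)
        moreover have "hyp_form k z (p u) = (norm (oct_one - (\<Sum>i<k. oct_cnj (z i) \<odot> p u i)))\<^sup>2"
          using z pV[OF u] by (intro hyp_form_eq_norm_square[OF F])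
        ultimately have "hyp_form k z (p u) = (A - B \<odot> u) \<bullet> (A - B \<odot> u)"
          by (simp add: power2_norm_eq_inner)
        also have "\<dots> = A \<bullet> A - 2 * ((B \<odot> u) \<bullet> A) + (B \<bullet> B) * (u \<bullet> u)"
          by (simp add: inner_diff_self oct_mult_inner_same inner_commute)
        also have "(B \<odot> u) \<bullet> A = (oct_cnj B \<odot> A) \<bullet> u"
          by (metis inner_commute oct_mult_adjoint_left)
        finally show ?thesis by simp
      qed
      ultimately show ?thesis
        by (intro exI[of _ "A \<bullet> A"] exI[of _ "- (oct_cnj B \<odot> A)"] exI[of _ "B \<bullet> B"])
          (simp add: oct_mult_inner_same oct_cnj_inner)
    qed
    show "hyp_form k (p u) (p v) =
      hyp_norm k (p u) * hyp_norm k (p v) + (\<alpha> * \<gamma> + \<beta> \<bullet> \<beta>) * ((u - v) \<bullet> (u - v))"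
      if u: "u \<in> ?V" and v: "v \<in> ?V" for u v
    proof -
      define \<kappa> where "\<kappa> = \<alpha> * \<gamma> + \<beta> \<bullet> \<beta>"
      define s where "s = oct_one - (\<Sum>i<k. oct_cnj (p u i) \<odot> p v i)"
      \<comment> \<open>Centring both parameters removes the linear terms: \<open>\<gamma> *\<^sub>R
        s = \<kappa> *\<^sub>R oct_one - oct_cnj U \<odot> W\<close>. The claim is then proved after
        multiplication by \<open>\<gamma>\<^sup>2\<close>.\<close>
      define U W where "U = \<gamma> *\<^sub>R u - \<beta>" and "W = \<gamma> *\<^sub>R v - \<beta>"
      have cnj_beta: "oct_cnj \<beta> = - (\<Sum>i<k. oct_cnj (x i) \<odot> q i)"
        by (simp add: \<beta>_def linear_neg[OF linear_oct_cnj] linear_sum[OF linear_oct_cnj] oct_cnj_mult)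
      have "(\<Sum>i<k. oct_cnj (p u i) \<odot> p v i) = (\<Sum>i<k. (x i \<bullet> x i) *\<^sub>R oct_one + (oct_cnj (x i) \<odot> q i) \<odot> v
          + oct_cnj u \<odot> (oct_cnj (q i) \<odot> x i) + (q i \<bullet> q i) *\<^sub>R (oct_cnj u \<odot> v))"
      proof (intro sum.cong refl)
        fix i
        have "(oct_cnj u \<odot> oct_cnj (q i)) \<odot> (q i \<odot> v) = (q i \<bullet> q i) *\<^sub>R (oct_cnj u \<odot> v)"
          by (simp add: assoc u v qV scalars_cnj scalars_mult oct_mult_cnj_left oct_mult.scaleR_right)
        moreover have "oct_cnj (x i) \<odot> (q i \<odot> v) = (oct_cnj (x i) \<odot> q i) \<odot> v"
          by (simp add: assoc v qV xV scalars_cnj)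
        moreover have "(oct_cnj u \<odot> oct_cnj (q i)) \<odot> x i = oct_cnj u \<odot> (oct_cnj (q i) \<odot> x i)"
          by (simp add: assoc u qV xV scalars_cnj)
        ultimately show "oct_cnj (p u i) \<odot> p v i = (x i \<bullet> x i) *\<^sub>R oct_one + (oct_cnj (x i) \<odot> q i) \<odot> v
          + oct_cnj u \<odot> (oct_cnj (q i) \<odot> x i) + (q i \<bullet> q i) *\<^sub>R (oct_cnj u \<odot> v)"
          by (simp add: p_def linear_add[OF linear_oct_cnj] oct_cnj_mult oct_mult.add_left oct_mult.add_right
              oct_cnj_mult_self)
      qed
      also have "\<dots> = (1 - \<alpha>) *\<^sub>R oct_one - oct_cnj \<beta> \<odot> v - oct_cnj u \<odot> \<beta> + \<gamma> *\<^sub>R (oct_cnj u \<odot> v)"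
        unfolding cnj_beta unfolding \<beta>_def \<gamma>_def \<alpha>_def hyp_norm_def
        by (simp add: sum.distrib oct_mult.sum_left oct_mult.sum_right oct_mult.minus_left oct_mult.minus_right
            scaleR_left.sum)
      finally have s0: "s = \<alpha> *\<^sub>R oct_one + oct_cnj \<beta> \<odot> v + oct_cnj u \<odot> \<beta> - \<gamma> *\<^sub>R (oct_cnj u \<odot> v)"
        by (simp add: s_def scaleR_left_diff_distrib)
      have s: "\<gamma> *\<^sub>R s = \<kappa> *\<^sub>R oct_one - oct_cnj U \<odot> W"
        unfolding s0 by (simp add: \<kappa>_def U_def W_def linear_diff[OF linear_oct_cnj] linear_scale[OF linear_oct_cnj]
            oct_mult.diff_left oct_mult.diff_right oct_mult.scaleR_left oct_mult.scaleR_right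
            oct_cnj_mult_self algebra_simps)
      have "hyp_form k (p u) (p v) = s \<bullet> s"
        using hyp_form_eq_norm_square[OF F pV[OF u] pV[OF v]] by (simp only: s_def power2_norm_eq_inner)
      hence "\<gamma>\<^sup>2 * hyp_form k (p u) (p v) = (\<gamma> *\<^sub>R s) \<bullet> (\<gamma> *\<^sub>R s)"
        by (simp add: power2_eq_square)
      also have "\<dots> = \<kappa>\<^sup>2 - 2 * \<kappa> * (U \<bullet> W) + (U \<bullet> U) * (W \<bullet> W)"
        unfolding s inner_diff_self
        by (simp add: oct_one_inner_mult oct_mult_inner_same oct_cnj_inner power2_eq_square)
      also have "\<dots> = (\<kappa> - U \<bullet> U) * (\<kappa> - W \<bullet> W) + \<kappa> * ((U - W) \<bullet> (U - W))"
        by (simp add: inner_diff_self inner_commute[of W U] power2_eq_square algebra_simps)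
      also have "U - W = \<gamma> *\<^sub>R (u - v)" by (simp add: U_def W_def algebra_simps)
      also have "\<kappa> - U \<bullet> U = \<gamma> * hyp_norm k (p u)"
        by (simp add: N \<kappa>_def U_def inner_diff_self algebra_simps inner_commute)
      also have "\<kappa> - W \<bullet> W = \<gamma> * hyp_norm k (p v)"
        by (simp add: N \<kappa>_def W_def inner_diff_self algebra_simps inner_commute)
      finally have "\<gamma>\<^sup>2 * hyp_form k (p u) (p v) =
          \<gamma>\<^sup>2 * (hyp_norm k (p u) * hyp_norm k (p v) + \<kappa> * ((u - v) \<bullet> (u - v)))"
        by (simp add: power2_eq_square distrib_left mult_ac)
      thus ?thesis using \<gamma> by (simp add: \<kappa>_def)
    qed
  qed
qed

section \<open>Octonionic lines\<close>

lemma oct_line_null_quadratic: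
  assumes p: "\<And>u. p u 0 = c + \<epsilon> *\<^sub>R u" "\<And>u. p u 1 = b + m \<odot> u"
  shows "\<exists>a l e. l \<in> UNIV \<and> 0 \<le> e \<and> l \<bullet> l = a * e \<and>
    (\<forall>u\<in>UNIV. hyp_form 2 z (p u) = a + 2 * (l \<bullet> u) + e * (u \<bullet> u))"
proof -
  \<comment> \<open>Factoring the fixed point \<open>z\<close> makes the form the squared norm of
    \<open>A - oct_cnj t \<odot> (n \<odot> u)\<close>, which expands by adjoints and
    multiplicativity of the norm alone. The value \<open>\<epsilon> = 1\<close> will serve for
    graphs and \<open>\<epsilon> = 0\<close> for vertical lines.\<close>
  obtain s t r where st: "z 0 = s \<odot> t" "z 1 = r *\<^sub>R t" by (rule oct_pair_factor)
  define A where "A = oct_one - oct_cnj t \<odot> (oct_cnj s \<odot> c + r *\<^sub>R b)"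
  define n where "n = \<epsilon> *\<^sub>R oct_cnj s + r *\<^sub>R m"
  let ?l = "- (oct_cnj n \<odot> (t \<odot> A))"
  have "hyp_form 2 z (p u) = A \<bullet> A + 2 * (?l \<bullet> u) + (n \<bullet> n) * (t \<bullet> t) * (u \<bullet> u)" for u
  proof -
    have "oct_one - oct_cnj t \<odot> (oct_cnj s \<odot> p u 0 + r *\<^sub>R p u 1) = A - oct_cnj t \<odot> (n \<odot> u)"
      unfolding A_def n_def p
      by (simp add: oct_mult.add_left oct_mult.add_right oct_mult.scaleR_left oct_mult.scaleR_right
          scaleR_add_right del: One_nat_def)
    hence "hyp_form 2 z (p u) = (A - oct_cnj t \<odot> (n \<odot> u)) \<bullet> (A - oct_cnj t \<odot> (n \<odot> u))"
      using hyp_form_2_factor[OF st, of "p u"] by (simp only: power2_norm_eq_inner)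
    also have "\<dots> = A \<bullet> A - 2 * ((oct_cnj t \<odot> (n \<odot> u)) \<bullet> A) + (n \<bullet> n) * (t \<bullet> t) * (u \<bullet> u)"
      by (simp add: inner_diff_self oct_mult_inner_same oct_cnj_inner inner_commute)
    also have "(oct_cnj t \<odot> (n \<odot> u)) \<bullet> A = (oct_cnj n \<odot> (t \<odot> A)) \<bullet> u"
      by (metis inner_commute oct_cnj_cnj oct_mult_adjoint_left)
    finally show ?thesis by simp
  qed
  thus ?thesis
    by (intro exI[of _ "A \<bullet> A"] exI[of _ ?l] exI[of _ "(n \<bullet> n) * (t \<bullet> t)"])
      (simp add: oct_mult_inner_same oct_cnj_inner)
qed

lemma oct_line_norm:
  assumes p: "\<And>u. p u 0 = c + \<epsilon> *\<^sub>R u" "\<And>u. p u 1 = b + m \<odot> u"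
  shows "hyp_norm 2 (p u) = (1 - c \<bullet> c - b \<bullet> b) + 2 * (- (\<epsilon> *\<^sub>R c + oct_cnj m \<odot> b) \<bullet> u)
    - (\<epsilon>\<^sup>2 + m \<bullet> m) * (u \<bullet> u)"
proof -
  have "b \<bullet> (m \<odot> u) = (oct_cnj m \<odot> b) \<bullet> u" by (metis inner_commute oct_mult_adjoint_left)
  moreover have "hyp_norm 2 (p u) = 1 - p u 0 \<bullet> p u 0 - p u 1 \<bullet> p u 1"
    by (simp add: hyp_norm_def numeral_2_eq_2)
  ultimately show ?thesis
    unfolding p
    by (simp add: inner_add inner_commute[of "m \<odot> u" b] inner_commute[of u c] oct_mult_inner_same
        power2_eq_square algebra_simps)
qed

text \<open>An octonionic line is either a graph \<open>u \<mapsto> (u, b + m \<odot> u)\<close> or vertical, \<open>u \<mapsto> (c, u)\<close>.\<close>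

lemma oct_graph_form:
  assumes p: "\<And>u. p u 0 = u" "\<And>u. p u 1 = b + m \<odot> u"
  shows "hyp_form 2 (p u) (p v) = hyp_norm 2 (p u) * hyp_norm 2 (p v)
    + ((1 - b \<bullet> b) * (1 + m \<bullet> m) + (oct_cnj m \<odot> b) \<bullet> (oct_cnj m \<odot> b)) * ((u - v) \<bullet> (u - v))"
proof -
  define e where "e = oct_cnj m \<odot> b"
  have e: "e \<bullet> e = (m \<bullet> m) * (b \<bullet> b)" by (simp add: e_def oct_mult_inner_same oct_cnj_inner)
  have be: "b \<bullet> (m \<odot> w) = e \<bullet> w" "(m \<odot> w) \<bullet> b = e \<bullet> w" for w
    unfolding e_def by (metis inner_commute oct_mult_adjoint_left)+
  \<comment> \<open>Alternativity collapses \<open>w \<odot> (oct_cnj w \<odot> oct_cnj m)\<close>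
    to a multiple of \<open>oct_cnj m\<close>.\<close>
  have col: "w \<odot> oct_cnj (b + m \<odot> w) = w \<odot> oct_cnj b + (w \<bullet> w) *\<^sub>R oct_cnj m" for w
    using oct_mult_cnj_left[of "oct_cnj w" "oct_cnj m"]
    by (simp add: linear_add[OF linear_oct_cnj] oct_cnj_mult oct_mult.add_right oct_cnj_inner)
  have cross: "(w \<odot> oct_cnj b) \<bullet> oct_cnj m = e \<bullet> w" for w
    unfolding e_def by (metis inner_commute oct_cnj_cnj oct_mult_adjoint_right)
  have F: "(u \<odot> oct_cnj (b + m \<odot> u)) \<bullet> (v \<odot> oct_cnj (b + m \<odot> v)) =
      (b \<bullet> b) * (u \<bullet> v) + (v \<bullet> v) * (e \<bullet> u) + (u \<bullet> u) * (e \<bullet> v) + (u \<bullet> u) * (v \<bullet> v) * (m \<bullet> m)"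
    unfolding col
    by (simp add: inner_add cross inner_commute[of "oct_cnj m" "_ \<odot> _"] oct_cnj_inner oct_mult_inner_right_same
        algebra_simps)
  have I: "(b + m \<odot> u) \<bullet> (b + m \<odot> v) = b \<bullet> b + e \<bullet> u + e \<bullet> v + (m \<bullet> m) * (u \<bullet> v)" for u v
    by (simp add: inner_add be oct_mult_inner_left_same)
  have N: "hyp_norm 2 (p w) = 1 - w \<bullet> w - (b + m \<odot> w) \<bullet> (b + m \<odot> w)" for w
    by (simp add: hyp_norm_def numeral_2_eq_2 p p(2)[unfolded One_nat_def])
  show ?thesis
    unfolding hyp_form_2 p N F I inner_diff_self e_def[symmetric] e
    by (simp add: algebra_simps)
qed

lemma oct_vertical_form:
  assumes p: "\<And>u. p u 0 = c" "\<And>u. p u 1 = u"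
  shows "hyp_form 2 (p u) (p v) = hyp_norm 2 (p u) * hyp_norm 2 (p v) + (1 - c \<bullet> c) * ((u - v) \<bullet> (u - v))"
proof -
  have "hyp_norm 2 (p w) = 1 - c \<bullet> c - w \<bullet> w" for w
    by (simp add: hyp_norm_def numeral_2_eq_2 p p(2)[unfolded One_nat_def])
  note N = this[of u] this[of v]
  show ?thesis
    unfolding hyp_form_2 p inner_diff_self N
    by (simp add: oct_mult_inner_left_same oct_cnj_inner algebra_simps)
qed

lemma F_line_chart_octonion:
  assumes x: "x \<in> hyp_space Octonion_alg 2" and y: "y \<in> hyp_space Octonion_alg 2" and "x \<noteq> y"
  shows "\<exists>P. F_line_chart Octonion_alg 2 P \<and> x \<in> P ` UNIV \<and> y \<in> P ` UNIV"
proof -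
  have vanish: "x i = 0" "y i = 0" if "2 \<le> i" for i using that x y by (auto simp: hyp_space_iff)
  have two: "i < 2 \<longleftrightarrow> i = 0 \<or> i = 1" for i :: nat by auto
  define pt where "pt a b = (\<lambda>i::nat. if i = 0 then a else if i = 1 then b else 0)" for a b :: oct
  have pt: "pt a b 0 = a" "pt a b 1 = b" "\<And>i. 2 \<le> i \<Longrightarrow> pt a b i = 0" for a b
    by (auto simp: pt_def)
  have eq_pt: "z = pt (z 0) (z 1)" if "z \<in> hyp_space Octonion_alg 2" for z
  proof
    fix i show "z i = pt (z 0) (z 1) i"
      using that by (cases "i < 2") (auto simp: pt_def hyp_space_iff two)
  qed
  show ?thesis
  proof (cases "x 0 = y 0")
    case False
    define \<delta> where "\<delta> = y 0 - x 0"
    \<comment> \<open>The slope of the line through the two points, a right quotient;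
      \<open>b\<close> is then the intercept.\<close>
    define m where "m = (y 1 - x 1) \<odot> ((1 / (\<delta> \<bullet> \<delta>)) *\<^sub>R oct_cnj \<delta>)"
    define b where "b = x 1 - m \<odot> x 0"
    define p where "p u = pt u (b + m \<odot> u)" for u
    have p: "p u 0 = u" "p u 1 = b + m \<odot> u" for u by (simp_all add: p_def pt del: One_nat_def)
    have "m \<odot> \<delta> = y 1 - x 1"
      using False oct_mult_cnj_right[of "y 1 - x 1" "oct_cnj \<delta>"]
      by (simp add: m_def oct_mult.scaleR_right oct_mult.scaleR_left oct_cnj_inner \<delta>_def)
    hence "b + m \<odot> y 0 = y 1" by (simp add: b_def \<delta>_def oct_mult.diff_right algebra_simps)
    hence py: "p (y 0) = y" using eq_pt[OF y] by (simp add: p_def)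
    have px: "p (x 0) = x" using eq_pt[OF x] by (simp add: p_def b_def)
    show ?thesis
    proof (rule F_line_chartI[where p = p and \<beta> = "- (oct_cnj m \<odot> b)" and \<gamma> = "1 + m \<bullet> m" and \<alpha> = "1 - b \<bullet> b"])
      show "0 < 1 + m \<bullet> m" by (simp add: add_pos_nonneg)
      show "hyp_norm 2 (p u) = 1 - b \<bullet> b + 2 * (- (oct_cnj m \<odot> b) \<bullet> u) - (1 + m \<bullet> m) * (u \<bullet> u)" for u
        using oct_line_norm[of p 0 1 b m u] by (simp add: p del: One_nat_def)
      show "\<exists>a l c. l \<in> UNIV \<and> 0 \<le> c \<and> l \<bullet> l = a * c \<and>
        (\<forall>u\<in>UNIV. hyp_form 2 z (p u) = a + 2 * (l \<bullet> u) + c * (u \<bullet> u))" for z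
        by (rule oct_line_null_quadratic[of p 0 1 b m]) (simp_all add: p del: One_nat_def)
      show "hyp_form 2 (p u) (p v) = hyp_norm 2 (p u) * hyp_norm 2 (p v) + ((1 - b \<bullet> b) * (1 + m \<bullet> m)
          + - (oct_cnj m \<odot> b) \<bullet> - (oct_cnj m \<odot> b)) * ((u - v) \<bullet> (u - v))" for u v
        using oct_graph_form[of p b m u v] by (simp add: p del: One_nat_def)
      show "x \<in> p ` UNIV \<inter> hyp_space Octonion_alg 2" using px x by (metis IntI rangeI)
      show "y \<in> p ` UNIV \<inter> hyp_space Octonion_alg 2" using py y by (metis IntI rangeI)
    qed (auto simp: p_def pt subspace_UNIV)
  next
    case True
    define p where "p u = pt (x 0) u" for u
    have p: "p u 0 = x 0" "p u 1 = u" for u by (simp_all add: p_def pt del: One_nat_def)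
    have py: "p (y 1) = y" using eq_pt[OF y] True by (simp add: p_def)
    have px: "p (x 1) = x" using eq_pt[OF x] by (simp add: p_def)
    show ?thesis
    proof (rule F_line_chartI[where p = p and \<beta> = 0 and \<gamma> = 1 and \<alpha> = "1 - x 0 \<bullet> x 0"])
      show "hyp_norm 2 (p u) = 1 - x 0 \<bullet> x 0 + 2 * (0 \<bullet> u) - 1 * (u \<bullet> u)" for u
        using oct_line_norm[of p "x 0" 0 0 oct_one u] by (simp add: p oct_mult.zero_right del: One_nat_def)
      show "\<exists>a l c. l \<in> UNIV \<and> 0 \<le> c \<and> l \<bullet> l = a * c \<and>
        (\<forall>u\<in>UNIV. hyp_form 2 z (p u) = a + 2 * (l \<bullet> u) + c * (u \<bullet> u))" for z
        by (rule oct_line_null_quadratic[of p "x 0" 0 0 oct_one]) (simp_all add: p del: One_nat_def)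
      show "hyp_form 2 (p u) (p v) = hyp_norm 2 (p u) * hyp_norm 2 (p v)
          + ((1 - x 0 \<bullet> x 0) * 1 + 0 \<bullet> 0) * ((u - v) \<bullet> (u - v))" for u v
        using oct_vertical_form[of p "x 0" u v] by (simp add: p del: One_nat_def)
      show "x \<in> p ` UNIV \<inter> hyp_space Octonion_alg 2" using px x by (metis IntI rangeI)
      show "y \<in> p ` UNIV \<inter> hyp_space Octonion_alg 2" using py y by (metis IntI rangeI)
    qed (auto simp: p_def pt subspace_UNIV)
  qed
qed

lemma F_line_chart_exists:
  assumes "F = Octonion_alg \<Longrightarrow> k = 2" "x \<in> hyp_space F k" "y \<in> hyp_space F k" "x \<noteq> y"
  shows "\<exists>P. F_line_chart F k P \<and> x \<in> P ` scalars F \<and> y \<in> P ` scalars F"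
proof (cases "F = Octonion_alg")
  case True
  thus ?thesis using F_line_chart_octonion[of x y] assms by simp
next
  case False
  thus ?thesis using F_line_chart_associative assms by blast
qed

section \<open>Real hyperbolic space\<close>

lemma hyperboloid_form_nonneg: "0 \<le> hyperboloid_form X Y"
proof -
  have "X \<bullet> Y \<le> norm X * norm Y" by (rule norm_cauchy_schwarz)
  also have "\<dots> \<le> sqrt (1 + X \<bullet> X) * sqrt (1 + Y \<bullet> Y)"
    by (intro mult_mono) (auto simp: norm_eq_sqrt_inner)
  finally show ?thesis by (simp add: hyperboloid_form_def)
qed

text \<open>Squaring the hypothesis exhibits \<open>(X - Y) \<bullet> (X - Y)\<close> as minus the
  defect in the Cauchy-Schwarz inequality, hence as nonpositive.\<close>

lemma hyperboloid_form_eq_1: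
  assumes "hyperboloid_form X Y = 1"
  shows "X = Y"
proof -
  have "sqrt (1 + X \<bullet> X) * sqrt (1 + Y \<bullet> Y) = 1 + X \<bullet> Y"
    using assms by (simp add: hyperboloid_form_def)
  hence "(sqrt (1 + X \<bullet> X) * sqrt (1 + Y \<bullet> Y))\<^sup>2 = (1 + X \<bullet> Y)\<^sup>2" by (rule arg_cong)
  hence "(1 + X \<bullet> X) * (1 + Y \<bullet> Y) = (1 + X \<bullet> Y)\<^sup>2" by (simp add: power_mult_distrib)
  moreover have "(X \<bullet> Y)\<^sup>2 \<le> (X \<bullet> X) * (Y \<bullet> Y)" by (rule Cauchy_Schwarz_ineq)
  ultimately have "(X - Y) \<bullet> (X - Y) \<le> 0"
    by (simp add: inner_diff_self inner_commute[of Y X] power2_eq_square algebra_simps)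
  hence "(X - Y) \<bullet> (X - Y) = 0" using inner_ge_zero[of "X - Y"] by linarith
  thus ?thesis by simp
qed

lemma hyp_norm_real: "hyp_norm n (\<lambda>i. if i < n then r i *\<^sub>R oct_one else 0) = 1 - (\<Sum>i<n. (r i)\<^sup>2)"
  by (simp add: hyp_norm_def power2_eq_square)

lemma hyp_form_real:
  "hyp_form n (\<lambda>i. if i < n then r i *\<^sub>R oct_one else 0) (\<lambda>i. if i < n then s i *\<^sub>R oct_one else 0)
    = (1 - (\<Sum>i<n. r i * s i))\<^sup>2"
proof -
  have "hyp_form n (\<lambda>i. if i < n then r i *\<^sub>R oct_one else 0) (\<lambda>i. if i < n then s i *\<^sub>R oct_one else 0)
    = (norm (oct_one - (\<Sum>i<n. (r i * s i) *\<^sub>R oct_one)))\<^sup>2"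
    by (subst hyp_form_eq_norm_square[of Real_alg])
      (auto simp: scalars_Real linear_scale[OF linear_oct_cnj] oct_mult.scaleR_left oct_mult.scaleR_right
        intro!: arg_cong[of _ _ norm] sum.cong simp del: scalars.simps)
  also have "oct_one - (\<Sum>i<n. (r i * s i) *\<^sub>R oct_one) = (1 - (\<Sum>i<n. r i * s i)) *\<^sub>R oct_one"
    by (simp add: scaleR_left.sum algebra_simps)
  finally show ?thesis by (simp add: power_mult_distrib norm_eq_sqrt_inner[of oct_one])
qed

text \<open>\<open>K\<close> is the central projection of the hyperboloid onto the Klein ball, read
  in an orthonormal basis of \<open>V\<close>. Over the reals \<open>hyp_form\<close> is a perfect
  square, so the Lorentz product appears as the cosh of the distance itself, not of its
  double.\<close>

lemma klein_model:
  fixes V :: "'a::euclidean_space set"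
  assumes V: "subspace V"
  shows "\<exists>K. bij_betw K V (hyp_space Real_alg (dim V)) \<and>
    (\<forall>X\<in>V. \<forall>Y\<in>V. cosh (hyp_dist (dim V) (K X) (K Y)) = hyperboloid_form X Y)"
proof -
  let ?n = "dim V"
  obtain B where B: "B \<subseteq> V" "pairwise orthogonal B" "\<And>x. x \<in> B \<Longrightarrow> norm x = 1"
    "independent B" "card B = ?n" "span B = V"
    using orthonormal_basis_subspace[OF V] by metis
  have fin: "finite B" using B(4) by (rule independent_imp_finite)
  obtain b where b: "bij_betw b {..<?n} B"
    using ex_bij_betw_nat_finite[OF fin] B(5) by (auto simp: atLeast0LessThan)
  have sumB: "(\<Sum>i<?n. g (b i)) = sum g B" for g :: "'a \<Rightarrow> 'c::comm_monoid_add"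
    using sum.reindex_bij_betw[OF b] .
  have bB: "b i \<in> B" if "i < ?n" for i using b that by (auto simp: bij_betw_def)
  have orth: "b i \<bullet> b j = (if i = j then 1 else 0)" if "i < ?n" "j < ?n" for i j
  proof (cases "i = j")
    case True thus ?thesis using B(3)[OF bB[OF that(2)]] by (simp add: norm_eq_1)
  next
    case False
    hence "b i \<noteq> b j" using b that by (auto simp: bij_betw_def inj_on_def)
    thus ?thesis using B(2) bB that False by (auto simp: pairwise_def orthogonal_def)
  qed
  have parseval: "(\<Sum>i<?n. (X \<bullet> b i) * (Y \<bullet> b i)) = X \<bullet> Y" if "X \<in> V" "Y \<in> V" for X Y
  proof -
    have "X \<bullet> Y = (\<Sum>e\<in>B. (X \<bullet> e) *\<^sub>R e) \<bullet> Y"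
      using orthonormal_basis_expand[OF B(2,3) _ fin, of X] that B(6) by simp
    also have "\<dots> = (\<Sum>i<?n. (X \<bullet> b i) * (Y \<bullet> b i))"
      by (simp add: inner_sum_left inner_commute[of Y] sumB[of "\<lambda>e. (X \<bullet> e) * (e \<bullet> Y)"])
    finally show ?thesis by simp
  qed
  define T :: "'a \<Rightarrow> real" where "T X = sqrt (1 + X \<bullet> X)" for X
  have T: "0 < T X" "(T X)\<^sup>2 = 1 + X \<bullet> X" for X
    by (simp_all add: T_def add_pos_nonneg)
  define K :: "'a \<Rightarrow> nat \<Rightarrow> oct" where "K X = (\<lambda>i. if i < ?n then ((X \<bullet> b i) / T X) *\<^sub>R oct_one else 0)" for X
  have normK: "hyp_norm ?n (K X) = 1 / (T X)\<^sup>2" if "X \<in> V" for X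
  proof -
    have "(\<Sum>i<?n. ((X \<bullet> b i) / T X)\<^sup>2) = (X \<bullet> X) / (T X)\<^sup>2"
      using parseval[OF that that]
      by (simp add: power_divide power2_eq_square[of "X \<bullet> _"] sum_divide_distrib[symmetric])
    also have "X \<bullet> X = (T X)\<^sup>2 - 1" using T(2)[of X] by simp
    also have "((T X)\<^sup>2 - 1) / (T X)\<^sup>2 = 1 - 1 / (T X)\<^sup>2"
      using T(1)[of X] by (simp add: diff_divide_distrib)
    finally show ?thesis by (simp add: K_def hyp_norm_real)
  qed
  have KH: "K X \<in> hyp_space Real_alg ?n" if "X \<in> V" for X
    using normK[OF that] T(1)[of X]
    by (auto simp: hyp_space_iff K_def scalars_Real simp del: scalars.simps)
  have dist: "cosh (hyp_dist ?n (K X) (K Y)) = hyperboloid_form X Y" if "X \<in> V" "Y \<in> V" for X Y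
  proof -
    have "(\<Sum>i<?n. (X \<bullet> b i) / T X * ((Y \<bullet> b i) / T Y)) = X \<bullet> Y / (T X * T Y)"
      using parseval[OF that] by (simp add: sum_divide_distrib[symmetric])
    hence "hyp_form ?n (K X) (K Y) = (1 - X \<bullet> Y / (T X * T Y))\<^sup>2"
      by (simp add: K_def hyp_form_real)
    moreover have "(cosh (hyp_dist ?n (K X) (K Y)))\<^sup>2
        = hyp_form ?n (K X) (K Y) / (hyp_norm ?n (K X) * hyp_norm ?n (K Y))"
      by (rule cosh_hyp_dist(1)[OF _ KH[OF that(1)] KH[OF that(2)]]) simp
    ultimately have "(cosh (hyp_dist ?n (K X) (K Y)))\<^sup>2 = ((1 - X \<bullet> Y / (T X * T Y)) * (T X * T Y))\<^sup>2"
      by (simp add: normK that power_mult_distrib)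
    also have "(1 - X \<bullet> Y / (T X * T Y)) * (T X * T Y) = hyperboloid_form X Y"
      using T(1)[of X] T(1)[of Y] by (simp add: hyperboloid_form_def T_def[symmetric] field_simps)
    finally show ?thesis
      by (rule power2_eq_imp_eq) (use hyperboloid_form_nonneg in auto)
  qed
  have "inj_on K V"
  proof (rule inj_onI)
    fix X Y assume XY: "X \<in> V" "Y \<in> V" "K X = K Y"
    have "hyp_dist ?n (K X) (K Y) = 0"
      using semimetric_hyp[of Real_alg ?n] KH XY by (auto simp: semimetric_on_def)
    thus "X = Y" using dist[OF XY(1,2)] by - (rule hyperboloid_form_eq_1, simp)
  qed
  moreover have "K ` V = hyp_space Real_alg ?n"
  proof
    show "K ` V \<subseteq> hyp_space Real_alg ?n" using KH by auto
    show "hyp_space Real_alg ?n \<subseteq> K ` V"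
    proof
      fix z assume z: "z \<in> hyp_space Real_alg ?n"
      hence "\<forall>i. \<exists>r. i < ?n \<longrightarrow> z i = r *\<^sub>R oct_one"
        by (auto simp: hyp_space_iff scalars_Real simp del: scalars.simps)
      then obtain r where r: "\<And>i. i < ?n \<Longrightarrow> z i = r i *\<^sub>R oct_one" by metis
      have zr: "z = (\<lambda>i. if i < ?n then r i *\<^sub>R oct_one else 0)"
        using z r by (auto simp: hyp_space_iff)
      define Y where "Y = (\<Sum>i<?n. r i *\<^sub>R b i)"
      have YV: "Y \<in> V" unfolding Y_def using V bB B(1) by (intro subspace_sum subspace_scale) auto
      have Yb: "Y \<bullet> b j = r j" if "j < ?n" for j
        using that by (simp add: Y_def inner_sum_left orth if_distrib cong: if_cong)
      have YY: "Y \<bullet> Y = (\<Sum>i<?n. (r i)\<^sup>2)"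
        using parseval[OF YV YV] by (simp add: Yb power2_eq_square)
      have lt: "0 < 1 - Y \<bullet> Y" using hyp_norm_pos[OF z] unfolding zr hyp_norm_real YY .
      \<comment> \<open>The point of the hyperboloid on the ray through
        \<open>(1, Y)\<close>.\<close>
      define X where "X = (1 / sqrt (1 - Y \<bullet> Y)) *\<^sub>R Y"
      have XV: "X \<in> V" using V YV by (simp add: X_def subspace_scale)
      have "1 + X \<bullet> X = (1 / sqrt (1 - Y \<bullet> Y))\<^sup>2"
        using lt by (simp add: X_def power_divide field_simps)
      hence TX: "T X = 1 / sqrt (1 - Y \<bullet> Y)" using lt by (simp add: T_def)
      have "K X = z"
        unfolding zr K_def TX using lt by (auto simp: X_def Yb)
      thus "z \<in> K ` V" using XV by blast
    qed
  qed
  ultimately have "bij_betw K V (hyp_space Real_alg ?n)" by (simp add: bij_betw_def)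
  thus ?thesis using dist by blast
qed

lemma F_line_chart_subset: "F_line_chart F k P \<Longrightarrow> P ` scalars F \<subseteq> hyp_space F k"
  by (simp add: F_line_chart_def pythagorean_def)

text \<open>The function \<open>sinh\<close> parametrises the one-dimensional hyperboloid; doubling
  its argument matches the doubled distance in \<open>F_line_chart\<close>.\<close>

lemma real_chart_geodesic:
  assumes "F_line_chart Real_alg k P"
  shows "\<exists>\<gamma>. range \<gamma> = P ` scalars Real_alg \<and> (\<forall>s t. hyp_dist k (\<gamma> s) (\<gamma> t) = \<bar>s - t\<bar>)"
proof -
  define \<gamma> where "\<gamma> t = P (sinh (2 * t) *\<^sub>R oct_one)" for t :: real
  have m: "r *\<^sub>R oct_one \<in> scalars Real_alg" for r by (subst scalars_Real) blast
  have "hyp_dist k (\<gamma> s) (\<gamma> t) = \<bar>s - t\<bar>" for s t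
  proof -
    have c: "sqrt (1 + sinh a * sinh a) = cosh a" for a :: real
      using cosh_square_eq[of a] by (simp add: power2_eq_square add.commute real_sqrt_unique)
    have "\<gamma> s \<in> hyp_space Real_alg k" "\<gamma> t \<in> hyp_space Real_alg k"
      using F_line_chart_subset[OF assms] m by (auto simp: \<gamma>_def simp del: scalars.simps)
    hence nn: "0 \<le> hyp_dist k (\<gamma> s) (\<gamma> t)" by (intro cosh_hyp_dist(2)[of Real_alg]) auto
    have "cosh (2 * hyp_dist k (\<gamma> s) (\<gamma> t)) = hyperboloid_form (sinh (2 * s) *\<^sub>R oct_one) (sinh (2 * t) *\<^sub>R oct_one)"
      using assms m unfolding F_line_chart_def \<gamma>_def by blast
    also have "\<dots> = cosh (2 * s - 2 * t)" by (simp add: hyperboloid_form_def c cosh_diff)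
    also have "\<dots> = cosh \<bar>2 * s - 2 * t\<bar>" by simp
    finally show ?thesis using nn cosh_real_nonneg_eq_iff[of "2 * hyp_dist k (\<gamma> s) (\<gamma> t)" "\<bar>2 * s - 2 * t\<bar>"] by simp
  qed
  moreover have "range \<gamma> = P ` scalars Real_alg"
  proof
    show "range \<gamma> \<subseteq> P ` scalars Real_alg" using m by (auto simp: \<gamma>_def simp del: scalars.simps)
    show "P ` scalars Real_alg \<subseteq> range \<gamma>"
    proof
      fix z assume "z \<in> P ` scalars Real_alg"
      then obtain r where "z = P (r *\<^sub>R oct_one)" by (auto simp: scalars_Real simp del: scalars.simps)
      hence "z = \<gamma> (arsinh r / 2)" by (simp add: \<gamma>_def)
      thus "z \<in> range \<gamma>" by blast
    qed
  qed
  ultimately show ?thesis by blast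
qed

section \<open>Triangle inequality and geodesics in real hyperbolic space\<close>

lemma triangle_on_subset: "triangle_on M d \<Longrightarrow> L \<subseteq> M \<Longrightarrow> triangle_on L d"
  unfolding triangle_on_def by blast

text \<open>Projecting the intermediate point to the geodesic through \<open>x\<close> and
  \<open>y\<close> lengthens neither leg, and on the geodesic the inequality is that of the real
  line.\<close>

lemma pythagorean_geodesics_triangle:
  assumes M: "semimetric_on M d"
    and geo: "\<And>x y. x \<in> M \<Longrightarrow> y \<in> M \<Longrightarrow> x \<noteq> y \<Longrightarrow> \<exists>\<gamma>. x \<in> range \<gamma> \<and> y \<in> range \<gamma> \<and>
      pythagorean M d (range \<gamma>) \<and> (\<forall>s t :: real. d (\<gamma> s) (\<gamma> t) = \<bar>s - t\<bar>)"
  shows "triangle_on M d"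
  unfolding triangle_on_def
proof (intro ballI)
  fix x w y assume m: "x \<in> M" "w \<in> M" "y \<in> M"
  show "d x y \<le> d x w + d w y"
  proof (cases "x = y")
    case True
    have "d x y = 0" "0 \<le> d x w" "0 \<le> d w y" using M m True by (simp_all add: semimetric_on_def)
    thus ?thesis by simp
  next
    case False
    obtain \<gamma> :: "real \<Rightarrow> 'a" where \<gamma>: "x \<in> range \<gamma>" "y \<in> range \<gamma>" "pythagorean M d (range \<gamma>)"
      "\<And>s t. d (\<gamma> s) (\<gamma> t) = \<bar>s - t\<bar>"
      using geo[OF m(1,3) False] by blast
    obtain v C where f: "foot d (range \<gamma>) w v C" and sub: "range \<gamma> \<subseteq> M"
      using \<gamma>(3) m(2) unfolding pythagorean_def by blast
    have le: "d v x \<le> d w x" "d v y \<le> d w y" using foot_le[OF M sub m(2) f] \<gamma>(1,2) by auto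
    have "v \<in> range \<gamma>" using f by (simp add: foot_def)
    hence "d x y \<le> d v x + d v y" using \<gamma>(1,2,4) by auto
    moreover have "d x w = d w x" using M m by (simp add: semimetric_on_def)
    ultimately show ?thesis using le by linarith
  qed
qed

text \<open>The inclusion lifts to a distance-preserving map of the parameter line, which is
  onto.\<close>

lemma geodesic_maximal:
  fixes f \<gamma> :: "real \<Rightarrow> 'a"
  assumes f: "\<And>s t. d (f s) (f t) = \<bar>s - t\<bar>" and \<gamma>: "\<And>s t. d (\<gamma> s) (\<gamma> t) = \<bar>s - t\<bar>"
    and sub: "range f \<subseteq> range \<gamma>"
  shows "range f = range \<gamma>"
proof -
  have "\<forall>s. \<exists>t. f s = \<gamma> t" using sub by auto
  then obtain h where h: "\<And>s. f s = \<gamma> (h s)" by (auto dest: choice)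
  have "\<bar>h s - h t\<bar> = \<bar>s - t\<bar>" for s t using f[of s t] \<gamma>[of "h s" "h t"] by (simp add: h)
  hence "surj h" by (rule real_isometry_surj)
  moreover have "range f = \<gamma> ` range h" using h by auto
  ultimately have "range \<gamma> \<subseteq> range f" by simp
  thus ?thesis using sub by blast
qed

lemma real_geodesic_exists:
  assumes "x \<in> hyp_space Real_alg n" "y \<in> hyp_space Real_alg n" "x \<noteq> y"
  shows "\<exists>\<gamma>. x \<in> range \<gamma> \<and> y \<in> range \<gamma> \<and> pythagorean (hyp_space Real_alg n) (hyp_dist n) (range \<gamma>) \<and>
    (\<forall>s t :: real. hyp_dist n (\<gamma> s) (\<gamma> t) = \<bar>s - t\<bar>)"
proof -
  obtain P where P: "F_line_chart Real_alg n P" "x \<in> P ` scalars Real_alg" "y \<in> P ` scalars Real_alg"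
    using F_line_chart_exists[of Real_alg n x y] assms by blast
  obtain \<gamma> :: "real \<Rightarrow> nat \<Rightarrow> oct" where \<gamma>: "range \<gamma> = P ` scalars Real_alg"
    "\<And>s t. hyp_dist n (\<gamma> s) (\<gamma> t) = \<bar>s - t\<bar>"
    using real_chart_geodesic[OF P(1)] by blast
  have "pythagorean (hyp_space Real_alg n) (hyp_dist n) (range \<gamma>)"
    using P(1) by (simp only: F_line_chart_def \<gamma>(1))
  thus ?thesis using P(2,3) \<gamma> by (intro exI[of _ \<gamma>]) (simp del: scalars.simps)
qed

lemma triangle_real_hyp: "triangle_on (hyp_space Real_alg n) (hyp_dist n)"
  by (rule pythagorean_geodesics_triangle[OF semimetric_hyp real_geodesic_exists]) auto

lemma real_geodesic_unique:
  assumes p: "pythagorean (hyp_space Real_alg n) (hyp_dist n) (range \<gamma>)"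
    and \<gamma>: "\<And>s t :: real. hyp_dist n (\<gamma> s) (\<gamma> t) = \<bar>s - t\<bar>"
    and G: "geodesic_line (hyp_space Real_alg n) (hyp_dist n) G"
    and xy: "x \<in> range \<gamma>" "y \<in> range \<gamma>" "x \<in> G" "y \<in> G" "x \<noteq> y"
  shows "G = range \<gamma>"
proof -
  have "range \<gamma> \<subseteq> hyp_space Real_alg n" using p by (simp add: pythagorean_def)
  hence "totally_geodesic (hyp_space Real_alg n) (hyp_dist n) (range \<gamma>)"
    using p by (intro pythagorean_totally_geodesic semimetric_hyp triangle_on_subset[OF triangle_real_hyp]) auto
  hence "G \<subseteq> range \<gamma>" using G xy unfolding totally_geodesic_def by blast
  moreover obtain f where "range f = G" "\<And>s t. hyp_dist n (f s) (f t) = \<bar>s - t\<bar>"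
    using geodesic_lineE[OF G] by metis
  ultimately show ?thesis using geodesic_maximal[of "hyp_dist n" f \<gamma>] \<gamma> by blast
qed

text \<open>By uniqueness \<open>range c\<close> is a Pythagorean geodesic, so the foot of
  \<open>z\<close> on it is some \<open>c t0\<close>, at distance \<open>\<bar>t - t0\<bar>\<close>
  from \<open>c t\<close>.\<close>

lemma cosh_dist_real_geodesic:
  assumes c: "\<And>t. c t \<in> hyp_space Real_alg n" "\<And>s t :: real. hyp_dist n (c s) (c t) = \<bar>s - t\<bar>"
    and z: "z \<in> hyp_space Real_alg n"
  shows "\<exists>C t0. \<forall>t. cosh (hyp_dist n z (c t)) = C * cosh (t - t0)"
proof -
  have S: "semimetric_on (hyp_space Real_alg n) (hyp_dist n)" by (rule semimetric_hyp) auto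
  have "c 0 \<noteq> c 1"
  proof
    assume "c 0 = c 1"
    hence "hyp_dist n (c 0) (c 1) = 0" using S c(1) unfolding semimetric_on_def by blast
    thus False using c(2)[of 0 1] by simp
  qed
  then obtain \<gamma> :: "real \<Rightarrow> nat \<Rightarrow> oct" where \<gamma>: "c 0 \<in> range \<gamma>" "c 1 \<in> range \<gamma>"
    "pythagorean (hyp_space Real_alg n) (hyp_dist n) (range \<gamma>)" "\<And>s t. hyp_dist n (\<gamma> s) (\<gamma> t) = \<bar>s - t\<bar>"
    using real_geodesic_exists[OF c(1) c(1)] by blast
  have "geodesic_line (hyp_space Real_alg n) (hyp_dist n) (range c)"
    by (rule geodesic_line_range[OF S]) (rule c)+
  hence "range c = range \<gamma>"
    by (rule real_geodesic_unique[OF \<gamma>(3) \<gamma>(4) _ \<gamma>(1,2) _ _ \<open>c 0 \<noteq> c 1\<close>]) auto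
  then obtain w C where f: "foot (hyp_dist n) (range c) z w C"
    using \<gamma>(3) z unfolding pythagorean_def by auto
  then obtain t0 where t0: "w = c t0" by (auto simp: foot_def)
  have "cosh (hyp_dist n z (c t)) = C * cosh (t - t0)" for t
  proof -
    have "cosh (hyp_dist n z (c t)) = C * cosh \<bar>t0 - t\<bar>" using f t0 c(2) by (auto simp: foot_def)
    also have "cosh \<bar>t0 - t\<bar> = cosh (t - t0)" by (cases "t0 \<le> t") (simp_all add: cosh_minus[of "t - t0", symmetric] del: cosh_minus)
    finally show ?thesis .
  qed
  thus ?thesis by blast
qed

section \<open>Uniqueness of lines\<close>

text \<open>Halving the distance gives curvature \<open>-4\<close>.\<close>

definition half_model :: "nat \<Rightarrow> ('a \<Rightarrow> 'a \<Rightarrow> real) \<Rightarrow> ((nat \<Rightarrow> oct) \<Rightarrow> 'a) \<Rightarrow> 'a set \<Rightarrow> bool" where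
  "half_model n d J L \<longleftrightarrow> bij_betw J (hyp_space Real_alg n) L \<and>
     (\<forall>u\<in>hyp_space Real_alg n. \<forall>v\<in>hyp_space Real_alg n. d (J u) (J v) = hyp_dist n u v / 2)"

lemma half_model_inverse:
  assumes "half_model n d J L"
  defines "g \<equiv> inv_into (hyp_space Real_alg n) J"
  shows "x \<in> L \<Longrightarrow> g x \<in> hyp_space Real_alg n" and "x \<in> L \<Longrightarrow> J (g x) = x"
    and "u \<in> hyp_space Real_alg n \<Longrightarrow> J u \<in> L" and "u \<in> hyp_space Real_alg n \<Longrightarrow> g (J u) = u"
    and "x \<in> L \<Longrightarrow> y \<in> L \<Longrightarrow> hyp_dist n (g x) (g y) = 2 * d x y"
proof -
  have b: "bij_betw J (hyp_space Real_alg n) L" using assms by (simp add: half_model_def)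
  show 1: "g x \<in> hyp_space Real_alg n" and 2: "J (g x) = x" if "x \<in> L" for x
    using b that by (auto simp: g_def bij_betw_def intro: inv_into_into f_inv_into_f)
  show "J u \<in> L" and "g (J u) = u" if "u \<in> hyp_space Real_alg n"
    using b that by (auto simp: g_def bij_betw_def)
  assume xy: "x \<in> L" "y \<in> L"
  have "d (J (g x)) (J (g y)) = hyp_dist n (g x) (g y) / 2"
    using assms(1) 1 xy unfolding half_model_def by blast
  thus "hyp_dist n (g x) (g y) = 2 * d x y" using 2 xy by simp
qed

text \<open>Turns the isometry demanded by \<open>F_line\<close> around, so that lines are
  parametrised by real hyperbolic space.\<close>

lemma half_model_iff_isometric:
  "isometric L d (hyp_space Real_alg n) (\<lambda>u v. hyp_dist n u v / 2) \<longleftrightarrow> (\<exists>J. half_model n d J L)"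
proof
  assume "isometric L d (hyp_space Real_alg n) (\<lambda>u v. hyp_dist n u v / 2)"
  then obtain f where f: "bij_betw f L (hyp_space Real_alg n)"
    "\<And>x y. x \<in> L \<Longrightarrow> y \<in> L \<Longrightarrow> hyp_dist n (f x) (f y) / 2 = d x y"
    unfolding isometric_def by blast
  have "half_model n d (inv_into L f) L"
    unfolding half_model_def
  proof (intro conjI ballI)
    show "bij_betw (inv_into L f) (hyp_space Real_alg n) L" using f(1) by (rule bij_betw_inv_into)
    fix u v assume uv: "u \<in> hyp_space Real_alg n" "v \<in> hyp_space Real_alg n"
    have "inv_into L f w \<in> L" "f (inv_into L f w) = w" if "w \<in> hyp_space Real_alg n" for w
      using f(1) that by (auto simp: bij_betw_def intro: inv_into_into f_inv_into_f)
    thus "d (inv_into L f u) (inv_into L f v) = hyp_dist n u v / 2" using f(2) uv by metis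
  qed
  thus "\<exists>J. half_model n d J L" by blast
next
  assume "\<exists>J. half_model n d J L"
  then obtain J where J: "half_model n d J L" by blast
  define g where "g = inv_into (hyp_space Real_alg n) J"
  note g = half_model_inverse[OF J, folded g_def]
  have "bij_betw g L (hyp_space Real_alg n)" using g by (intro bij_betw_byWitness[of _ J]) auto
  thus "isometric L d (hyp_space Real_alg n) (\<lambda>u v. hyp_dist n u v / 2)"
    unfolding isometric_def using g(5) by (intro exI[of _ g]) auto
qed

text \<open>\<open>P\<close> and the Klein chart \<open>K\<close> carry the same hyperboloid form,
  at doubled and at simple distance respectively; hence \<open>P\<close> after the inverse of
  \<open>K\<close> halves distances.\<close>

lemma F_line_chart_half_model:
  assumes k: "F = Octonion_alg \<Longrightarrow> k = 2" and P: "F_line_chart F k P"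
  shows "\<exists>J. half_model (dim (scalars F)) (hyp_dist k) J (P ` scalars F)"
proof -
  let ?V = "scalars F" and ?n = "dim (scalars F)"
  obtain K where K: "bij_betw K ?V (hyp_space Real_alg ?n)"
    "\<And>X Y. X \<in> ?V \<Longrightarrow> Y \<in> ?V \<Longrightarrow> cosh (hyp_dist ?n (K X) (K Y)) = hyperboloid_form X Y"
    using klein_model[OF subspace_scalars] by blast
  have cosh_P: "cosh (2 * hyp_dist k (P X) (P Y)) = hyperboloid_form X Y" if "X \<in> ?V" "Y \<in> ?V" for X Y
    using P that by (simp add: F_line_chart_def)
  have KH: "K X \<in> hyp_space Real_alg ?n" if "X \<in> ?V" for X using K(1) that by (auto simp: bij_betw_def)
  have PH: "P X \<in> hyp_space F k" if "X \<in> ?V" for X using F_line_chart_subset[OF P] that by auto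
  have S: "semimetric_on (hyp_space F k) (hyp_dist k)" "semimetric_on (hyp_space Real_alg ?n) (hyp_dist ?n)"
    using semimetric_hyp[OF k] semimetric_hyp[of Real_alg ?n] by auto
  have eq: "hyp_dist ?n (K X) (K Y) = 2 * hyp_dist k (P X) (P Y)" if "X \<in> ?V" "Y \<in> ?V" for X Y
  proof -
    have "0 \<le> hyp_dist ?n (K X) (K Y)" "0 \<le> 2 * hyp_dist k (P X) (P Y)"
      using S KH PH that by (auto simp: semimetric_on_def)
    thus ?thesis using K(2)[OF that] cosh_P[OF that] cosh_real_nonneg_eq_iff by metis
  qed
  have "inj_on P ?V"
  proof (rule inj_onI)
    fix X Y assume XY: "X \<in> ?V" "Y \<in> ?V" "P X = P Y"
    have "hyp_dist k (P X) (P Y) = 0" using S(1) PH XY by (auto simp: semimetric_on_def)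
    thus "X = Y" using cosh_P[OF XY(1,2)] by - (rule hyperboloid_form_eq_1, simp)
  qed
  hence P': "bij_betw P ?V (P ` ?V)" by (rule inj_on_imp_bij_betw)
  have "half_model ?n (hyp_dist k) (P \<circ> inv_into ?V K) (P ` ?V)"
    unfolding half_model_def
  proof (intro conjI ballI)
    show "bij_betw (P \<circ> inv_into ?V K) (hyp_space Real_alg ?n) (P ` ?V)"
      using bij_betw_trans[OF bij_betw_inv_into[OF K(1)] P'] .
    fix u v assume uv: "u \<in> hyp_space Real_alg ?n" "v \<in> hyp_space Real_alg ?n"
    have w: "inv_into ?V K w \<in> ?V" "K (inv_into ?V K w) = w" if "w \<in> hyp_space Real_alg ?n" for w
      using K(1) that by (auto simp: bij_betw_def intro: inv_into_into f_inv_into_f)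
    show "hyp_dist k ((P \<circ> inv_into ?V K) u) ((P \<circ> inv_into ?V K) v) = hyp_dist ?n u v / 2"
      using eq[OF w(1)[OF uv(1)] w(1)[OF uv(2)]] by (simp add: w(2) uv)
  qed
  thus ?thesis by blast
qed

lemma half_model_triangle:
  assumes "half_model n d J L"
  shows "triangle_on L d"
proof -
  define g where "g = inv_into (hyp_space Real_alg n) J"
  note g = half_model_inverse[OF assms, folded g_def]
  show ?thesis
    unfolding triangle_on_def
  proof (intro ballI)
    fix x y z assume m: "x \<in> L" "y \<in> L" "z \<in> L"
    have "hyp_dist n (g x) (g z) \<le> hyp_dist n (g x) (g y) + hyp_dist n (g y) (g z)"
      using triangle_real_hyp g(1) m unfolding triangle_on_def by blast
    thus "d x z \<le> d x y + d y z" using g(5) m by simp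
  qed
qed

lemma half_model_geodesic:
  assumes "half_model n d J L" and xy: "x \<in> L" "y \<in> L" "x \<noteq> y"
  shows "\<exists>\<gamma>. x \<in> range \<gamma> \<and> y \<in> range \<gamma> \<and> range \<gamma> \<subseteq> L \<and> (\<forall>s t :: real. d (\<gamma> s) (\<gamma> t) = \<bar>s - t\<bar>)"
proof -
  define g where "g = inv_into (hyp_space Real_alg n) J"
  note g = half_model_inverse[OF assms(1), folded g_def]
  have "g x \<noteq> g y" using g(2) xy by metis
  then obtain c :: "real \<Rightarrow> nat \<Rightarrow> oct" where c: "g x \<in> range c" "g y \<in> range c"
    "range c \<subseteq> hyp_space Real_alg n" "\<And>s t. hyp_dist n (c s) (c t) = \<bar>s - t\<bar>"
    using real_geodesic_exists[OF g(1)[OF xy(1)] g(1)[OF xy(2)]] unfolding pythagorean_def by blast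
  define \<gamma> where "\<gamma> t = J (c (2 * t))" for t
  have mem: "J (c t) \<in> range \<gamma>" for t
    by (rule image_eqI[of _ _ "t / 2"]) (simp_all add: \<gamma>_def)
  have "d (\<gamma> s) (\<gamma> t) = \<bar>s - t\<bar>" for s t
  proof -
    have "d (\<gamma> s) (\<gamma> t) = hyp_dist n (c (2 * s)) (c (2 * t)) / 2"
      using assms(1) c(3) unfolding half_model_def \<gamma>_def by blast
    thus ?thesis using c(4) by simp
  qed
  moreover have "x \<in> range \<gamma>" "y \<in> range \<gamma>" using c(1,2) mem g(2) xy by (metis imageE)+
  moreover have "range \<gamma> \<subseteq> L" using c(3) g(3) by (auto simp: \<gamma>_def)
  ultimately show ?thesis by blast
qed

text \<open>Pulling back to real hyperbolic space doubles distances, so the parameter is halved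
  there to keep unit speed before \<open>cosh_dist_real_geodesic\<close> is applied.\<close>

lemma cosh_dist_half_model:
  assumes "half_model n d J L" and \<gamma>: "range \<gamma> \<subseteq> L" "\<And>s t :: real. d (\<gamma> s) (\<gamma> t) = \<bar>s - t\<bar>"
    and z: "z \<in> L"
  shows "\<exists>C t0. \<forall>t. cosh (2 * d z (\<gamma> t)) = C * cosh (2 * t - t0)"
proof -
  define g where "g = inv_into (hyp_space Real_alg n) J"
  note g = half_model_inverse[OF assms(1), folded g_def]
  have "\<exists>C t0. \<forall>t. cosh (hyp_dist n (g z) (g (\<gamma> (t / 2)))) = C * cosh (t - t0)"
  proof (rule cosh_dist_real_geodesic)
    show "g (\<gamma> (t / 2)) \<in> hyp_space Real_alg n" for t using g(1) \<gamma>(1) by blast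
    show "hyp_dist n (g (\<gamma> (s / 2))) (g (\<gamma> (t / 2))) = \<bar>s - t\<bar>" for s t
    proof -
      have "hyp_dist n (g (\<gamma> (s / 2))) (g (\<gamma> (t / 2))) = 2 * d (\<gamma> (s / 2)) (\<gamma> (t / 2))"
        using g(5) \<gamma>(1) by blast
      thus ?thesis using \<gamma>(2) by (simp add: abs_if)
    qed
  qed (rule g(1)[OF z])
  then obtain C t0 where C: "\<And>t. cosh (hyp_dist n (g z) (g (\<gamma> (t / 2)))) = C * cosh (t - t0)" by blast
  have "cosh (2 * d z (\<gamma> t)) = C * cosh (2 * t - t0)" for t
  proof -
    have "hyp_dist n (g z) (g (\<gamma> t)) = 2 * d z (\<gamma> t)" using g(5) \<gamma>(1) z by blast
    thus ?thesis using C[of "2 * t"] by simp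
  qed
  thus ?thesis by blast
qed

text \<open>The functional \<open>g 1 + g (- 1) - 2 * cosh 2 * g 0\<close> annihilates \<open>cosh (2 * t - t0)\<close> but not the
  constants.\<close>

lemma cosh_plus_constant_unique:
  assumes "\<And>t :: real. 1 + C * cosh (2 * t - t0) = a * (1 + C' * cosh (2 * t - t1))"
  shows "a = 1"
proof -
  have *: "C * cosh (2 - t0) + C * cosh (- 2 - t0) = 2 * cosh 2 * (C * cosh (- t0))" for C t0 :: real
    by (simp add: cosh_diff cosh_add algebra_simps)
  have "1 + C * cosh (2 - t0) = a * (1 + C' * cosh (2 - t1))"
    "1 + C * cosh (- 2 - t0) = a * (1 + C' * cosh (- 2 - t1))"
    "1 + C * cosh (- t0) = a * (1 + C' * cosh (- t1))"
    using assms[of 1] assms[of "- 1"] assms[of 0] by simp_all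
  moreover have "1 < cosh (2 :: real)" using cosh_real_nonneg_less_iff[of 0 2] by simp
  ultimately show ?thesis
  proof -
    define p q r p' q' r' where
      "p = C * cosh (2 - t0)" "q = C * cosh (- 2 - t0)" "r = C * cosh (- t0)"
      "p' = C' * cosh (2 - t1)" "q' = C' * cosh (- 2 - t1)" "r' = C' * cosh (- t1)"
    assume "1 + C * cosh (2 - t0) = a * (1 + C' * cosh (2 - t1))"
      "1 + C * cosh (- 2 - t0) = a * (1 + C' * cosh (- 2 - t1))"
      "1 + C * cosh (- t0) = a * (1 + C' * cosh (- t1))" and c: "1 < cosh (2 :: real)"
    hence "1 + p = a * (1 + p')" "1 + q = a * (1 + q')" "1 + r = a * (1 + r')"
      "p + q = 2 * cosh 2 * r" "p' + q' = 2 * cosh 2 * r'"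
      using *[of C t0] *[of C' t1] by (simp_all only: p_q_r_p'_q'_r'_def)
    hence "(1 - a) * (cosh 2 - 1) = 0" by algebra
    thus "a = 1" using c by simp
  qed
qed

lemma half_model_subset:
  assumes M: "semimetric_on M d" and L: "pythagorean M d L" "half_model n d J L"
    and L': "totally_geodesic M d L'" "half_model n d J' L'"
    and xy: "x \<in> L" "y \<in> L" "x \<in> L'" "y \<in> L'" "x \<noteq> y"
  shows "L' \<subseteq> L"
proof
  fix z assume z: "z \<in> L'"
  have LM: "L \<subseteq> M" and zM: "z \<in> M"
    using L(1) L'(1) z by (auto simp: pythagorean_def totally_geodesic_def)
  obtain \<gamma> :: "real \<Rightarrow> _" where \<gamma>: "x \<in> range \<gamma>" "y \<in> range \<gamma>" "range \<gamma> \<subseteq> L"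
    "\<And>s t. d (\<gamma> s) (\<gamma> t) = \<bar>s - t\<bar>"
    using half_model_geodesic[OF L(2) xy(1,2,5)] by blast
  have "geodesic_line M d (range \<gamma>)" using \<gamma>(3,4) LM by (intro geodesic_line_range[OF M]) auto
  \<comment> \<open>Total geodesy of \<open>L'\<close> is what brings the geodesic of
    \<open>L\<close> into \<open>L'\<close>, so that the formulas for curvature \<open>-4\<close>
    hold along one common curve.\<close>
  hence \<gamma>': "range \<gamma> \<subseteq> L'" using L'(1) \<gamma>(1,2) xy unfolding totally_geodesic_def by blast
  obtain w A where f: "foot d L z w A" using L(1) zM unfolding pythagorean_def by blast
  hence w: "w \<in> L" "1 \<le> A" by (auto simp: foot_def)
  obtain C t0 where C: "\<And>t. cosh (2 * d z (\<gamma> t)) = C * cosh (2 * t - t0)"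
    using cosh_dist_half_model[OF L'(2) \<gamma>' \<gamma>(4) z] by blast
  obtain C' t1 where C': "\<And>t. cosh (2 * d w (\<gamma> t)) = C' * cosh (2 * t - t1)"
    using cosh_dist_half_model[OF L(2) \<gamma>(3,4) w(1)] by blast
  \<comment> \<open>Squaring the Pythagorean relation and applying
    \<open>2 * (cosh s)\<^sup>2 = 1 + cosh (2 * s)\<close> on both sides.\<close>
  have "1 + C * cosh (2 * t - t0) = A\<^sup>2 * (1 + C' * cosh (2 * t - t1))" for t
  proof -
    have "cosh (d z (\<gamma> t)) = A * cosh (d w (\<gamma> t))" using f \<gamma>(3) by (auto simp: foot_def)
    thus ?thesis unfolding C[symmetric] C'[symmetric] by (simp add: cosh_double_cosh power_mult_distrib)
  qed
  hence "A\<^sup>2 = 1" by (rule cosh_plus_constant_unique)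
  hence "A = 1" using w(2) by (simp add: power2_eq_1_iff)
  thus "z \<in> L" using f by (auto simp: foot_def)
qed

section \<open>Nested half models coincide\<close>

lemma real_hyp_isometry_surj:
  fixes V :: "'a::euclidean_space set"
  assumes V: "subspace V" "n = dim V"
    and f: "\<And>u. u \<in> hyp_space Real_alg n \<Longrightarrow> f u \<in> hyp_space Real_alg n"
    and iso: "\<And>u v. u \<in> hyp_space Real_alg n \<Longrightarrow> v \<in> hyp_space Real_alg n \<Longrightarrow>
      hyp_dist n (f u) (f v) = hyp_dist n u v"
  shows "f ` hyp_space Real_alg n = hyp_space Real_alg n"
proof -
  obtain K where K: "bij_betw K V (hyp_space Real_alg n)"
    "\<And>X Y. X \<in> V \<Longrightarrow> Y \<in> V \<Longrightarrow> cosh (hyp_dist n (K X) (K Y)) = hyperboloid_form X Y"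
    using klein_model[OF V(1)] V(2) by blast
  let ?g = "inv_into V K"
  have KV: "K X \<in> hyp_space Real_alg n" if "X \<in> V" for X using K(1) that by (auto simp: bij_betw_def)
  have g: "?g u \<in> V" "K (?g u) = u" if "u \<in> hyp_space Real_alg n" for u
    using K(1) that by (auto simp: bij_betw_def intro: inv_into_into f_inv_into_f)
  \<comment> \<open>Conjugation by the Klein chart moves the question to the hyperboloid.\<close>
  have surj: "(\<lambda>X. ?g (f (K X))) ` V = V"
  proof (rule hyperboloid_isometry_surj[OF V(1)])
    show "?g (f (K X)) \<in> V" if "X \<in> V" for X using g f KV that by simp
    show "hyperboloid_form (?g (f (K X))) (?g (f (K Y))) = hyperboloid_form X Y" if "X \<in> V" "Y \<in> V" for X Y
      using K(2)[symmetric] g f KV that iso by simp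
  qed
  have "u \<in> f ` hyp_space Real_alg n" if u: "u \<in> hyp_space Real_alg n" for u
  proof -
    have "?g u \<in> (\<lambda>X. ?g (f (K X))) ` V" using g(1)[OF u] surj by simp
    then obtain X where X: "X \<in> V" "?g u = ?g (f (K X))" by auto
    hence "u = f (K X)" using g(2)[OF u] g(2)[OF f[OF KV[OF X(1)]]] by metis
    thus ?thesis using KV X(1) by blast
  qed
  thus ?thesis using f by blast
qed

lemma half_model_subset_eq:
  fixes V :: "'a::euclidean_space set"
  assumes V: "subspace V" "n = dim V"
    and L: "half_model n d J L" and L': "half_model n d J' L'" and sub: "L' \<subseteq> L"
  shows "L' = L"
proof
  define g where "g = inv_into (hyp_space Real_alg n) J"
  note g = half_model_inverse[OF L, folded g_def]
  have J': "J' u \<in> L'" "J' u \<in> L" if "u \<in> hyp_space Real_alg n" for u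
    using L' sub that by (auto simp: half_model_def bij_betw_def)
  \<comment> \<open>The parametrisation of \<open>L'\<close> read in that of \<open>L\<close> is a
    distance-preserving self-map of the model.\<close>
  have surj: "(\<lambda>u. g (J' u)) ` hyp_space Real_alg n = hyp_space Real_alg n"
  proof (rule real_hyp_isometry_surj[OF V])
    show "g (J' u) \<in> hyp_space Real_alg n" if "u \<in> hyp_space Real_alg n" for u using g(1) J' that by simp
    show "hyp_dist n (g (J' u)) (g (J' v)) = hyp_dist n u v"
      if "u \<in> hyp_space Real_alg n" "v \<in> hyp_space Real_alg n" for u v
    proof -
      have "d (J' u) (J' v) = hyp_dist n u v / 2" using L' that unfolding half_model_def by blast
      thus ?thesis using g(5) J'(2) that by simp
    qed
  qed
  show "L \<subseteq> L'"
  proof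
    fix x assume x: "x \<in> L"
    have "g x \<in> (\<lambda>u. g (J' u)) ` hyp_space Real_alg n" using g(1)[OF x] surj by simp
    then obtain u where u: "u \<in> hyp_space Real_alg n" "g x = g (J' u)" by auto
    hence "x = J' u" using g(2)[OF x] g(2)[OF J'(2)[OF u(1)]] by metis
    thus "x \<in> L'" using J'(1) u(1) by simp
  qed
qed (rule sub)

section \<open>The spanned line and its bisectors\<close>

lemma spanned_line_chart:
  assumes k: "F = Octonion_alg \<Longrightarrow> k = 2" and P: "F_line_chart F k P"
    and xy: "x \<in> P ` scalars F" "y \<in> P ` scalars F" "x \<noteq> y"
  shows "spanned_line F k x y = P ` scalars F"
  unfolding spanned_line_def
proof (rule the_equality)
  let ?H = "hyp_space F k" and ?d = "hyp_dist k" and ?L = "P ` scalars F"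
  have S: "semimetric_on ?H ?d" using k by (rule semimetric_hyp)
  have pyth: "pythagorean ?H ?d ?L" using P by (simp add: F_line_chart_def)
  obtain J where J: "half_model (dim (scalars F)) ?d J ?L" using F_line_chart_half_model[OF k P] by blast
  have tg: "totally_geodesic ?H ?d ?L"
    by (rule pythagorean_totally_geodesic[OF S half_model_triangle[OF J] pyth])
  \<comment> \<open>Over the reals \<open>F_line\<close> asks for a geodesic only, so existence and
    uniqueness come from the results on geodesics there and from half models otherwise.\<close>
  have real: "\<exists>\<gamma>. range \<gamma> = ?L \<and> (\<forall>s t :: real. ?d (\<gamma> s) (\<gamma> t) = \<bar>s - t\<bar>)" if "F = Real_alg"
    using real_chart_geodesic P that by blast
  have "F_line F k ?L"
  proof (cases "F = Real_alg")
    case True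
    then obtain \<gamma> :: "real \<Rightarrow> _" where \<gamma>: "range \<gamma> = ?L" "\<And>s t. ?d (\<gamma> s) (\<gamma> t) = \<bar>s - t\<bar>"
      using real by blast
    have "\<gamma> t \<in> ?H" for t using \<gamma>(1) F_line_chart_subset[OF P] by blast
    hence "geodesic_line ?H ?d (range \<gamma>)" by (rule geodesic_line_range[OF S]) (rule \<gamma>(2))
    thus ?thesis using True \<gamma>(1) by (simp add: F_line_def)
  next
    case False
    thus ?thesis using tg J by (auto simp: F_line_def half_model_iff_isometric)
  qed
  thus "F_line F k ?L \<and> x \<in> ?L \<and> y \<in> ?L" using xy by simp
  fix L' assume L': "F_line F k L' \<and> x \<in> L' \<and> y \<in> L'"
  show "L' = ?L"
  proof (cases "F = Real_alg")
    case True
    then obtain \<gamma> :: "real \<Rightarrow> _" where \<gamma>: "range \<gamma> = ?L" "\<And>s t. ?d (\<gamma> s) (\<gamma> t) = \<bar>s - t\<bar>"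
      using real by blast
    have "geodesic_line (hyp_space Real_alg k) ?d L'" using L' True by (simp add: F_line_def)
    thus ?thesis
      using real_geodesic_unique[of k \<gamma> L' x y] pyth \<gamma> xy L' True by metis
  next
    case False
    then obtain J' where "totally_geodesic ?H ?d L'" "half_model (dim (scalars F)) ?d J' L'"
      using L' by (auto simp: F_line_def half_model_iff_isometric)
    \<comment> \<open>The curvature comparison puts \<open>L'\<close> inside the line of the chart;
      equality follows because isometric self-maps of the model are onto.\<close>
    thus ?thesis
      using half_model_subset_eq[OF subspace_scalars refl J] half_model_subset[OF S pyth J] xy L' by metis
  qed
qed

theorem corollary9:
  fixes F :: division_algebra and k :: nat and x y :: "nat \<Rightarrow> oct"
  defines "H \<equiv> hyp_space F k" and "d \<equiv> hyp_dist k"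
  defines "L \<equiv> spanned_line F k x y"
  assumes "F = Octonion_alg \<Longrightarrow> k = 2"
    and "x \<in> H" and "y \<in> H" and "x \<noteq> y"
  shows "bisector H d x y = {z \<in> H. nearest_point d L z \<in> bisector L d x y}"
proof -
  obtain P where P: "F_line_chart F k P" "x \<in> P ` scalars F" "y \<in> P ` scalars F"
    using F_line_chart_exists[of F k x y] assms unfolding H_def by blast
  have L: "L = P ` scalars F"
    unfolding L_def by (rule spanned_line_chart[OF assms(4) P \<open>x \<noteq> y\<close>])
  have "semimetric_on H d" unfolding H_def d_def using assms(4) by (rule semimetric_hyp)
  moreover have "pythagorean H d L" using P(1) by (simp add: F_line_chart_def H_def d_def L)
  ultimately show ?thesis using P(2,3) by (intro bisector_pythagorean) (simp_all only: L)
qed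

end
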